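(* Let $F:\mathbb{R}^m\to\mathcal{P}(\mathbb{R}^n)$ be a continuous definable multifunction with compact values. For $a\in\mathrm{dom}\,F$ there exists a definable $\varphi\in\Phi_p$ such that $$\mathrm{dist}_H(F(x),F(a))\ge\varphi\big(d(x,F^{-1}(F(a)))\big),\qquad x\in K,$$ where $K$ is a compact neighbourhood of $a$ such that $K\subset\mathrm{dom}\,F$, and $F^{-1}(F(a))=\{x\in\mathbb{R}^m: F(x)=F(a)\}$ is the strong preimage.
   Context: Definable means definable in some o-minimal structure on the real field $(\mathbb{R},+,\cdot)$. A multifunction is a map $F:\mathbb{R}^m\to\mathcal{P}(\mathbb{R}^n)$; its domain is $\mathrm{dom}\,F=\{x: F(x)\ne\emptyset\}$, and it is definable if its graph $\{(x,y)\in\mathbb{R}^m\times\mathbb{R}^n: y\in F(x)\}$ is a definable set. For $b\in\overline{\mathrm{dom}\,F\setminus\{b\}}$: $\liminf_{x\to b}F(x)$ is the set of $y$ such that for every sequence $x_\nu\in\mathrm{dom}\,F\setminus\{b\}$ with $x_\nu\to b$ there are $y_\nu\in F(x_\nu)$ with $y_\nu\to y$; $\limsup_{x\to b}F(x)$ is the set of $y$ for which there exist a sequence $x_\nu\in\mathrm{dom}\,F\setminus\{b\}$, $x_\nu\to b$, and $y_\nu\in F(x_\nu)$ with $y_\nu\to y$. $F$ is continuous at $b\in\mathrm{dom}\,F$ when $\liminf_{x\to b}F(x)=\limsup_{x\to b}F(x)=F(b)$, and continuous when this holds at the points $b$ of $\mathrm{dom}\,F$. $d(x,S)$ is the Euclidean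 distance from $x$ to $S$. For non-empty compact sets $A,B$, $\mathrm{dist}_H(A,B)=\max\{\max_{x\in A}d(x,B),\max_{x\in B}d(x,A)\}$. $p\ge1$ is any integer fixed a priori, and $\Phi_p$ is the set of all odd, increasing bijections $\phi:\mathbb{R}\to\mathbb{R}$ of class $\mathcal{C}^p$ with $\phi^{(k)}(0)=0$ for $k\in\{1,\dots,p\}$.
   Formalization: The compact neighbourhood K is assumed definable in the same o-minimal structure as F and φ; for arbitrary compact neighbourhoods K contained in dom F the claim can fail when dom F is not locally closed. *)

theory Defs
  imports "HOL-Analysis.Analysis"
begin

section \<open>O-minimal structures on the real field\<close>

text \<open>Points of real coordinate space of dimension \<open>n\<close> are real lists of length \<open>n\<close>, because a
  structure is a family of sets ranging over all dimensions.  The axioms are those of van den Dries;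
  constants need no separate axiom, since the one-dimensional sets include all points.\<close>

definition points :: "nat \<Rightarrow> real list set"
  where "points n = {xs. length xs = n}"

locale o_minimal_structure =
  fixes S :: "nat \<Rightarrow> real list set set"
  assumes subset_points: "A \<in> S n \<Longrightarrow> A \<subseteq> points n"
    and empty_in: "{} \<in> S n"
    and Un_in: "A \<in> S n \<Longrightarrow> B \<in> S n \<Longrightarrow> A \<union> B \<in> S n"
    and Compl_in: "A \<in> S n \<Longrightarrow> points n - A \<in> S n"
    and Cons_in: "A \<in> S n \<Longrightarrow> {x # xs | x xs. xs \<in> A} \<in> S (Suc n)"
    and snoc_in: "A \<in> S n \<Longrightarrow> {xs @ [x] | x xs. xs \<in> A} \<in> S (Suc n)"
    and diagonal_in: "n \<ge> 1 \<Longrightarrow> {xs \<in> points n. hd xs = last xs} \<in> S n"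
    and projection_in: "A \<in> S (Suc n) \<Longrightarrow> butlast ` A \<in> S n"
    and less_in: "{[x, y] | x y. x < y} \<in> S 2"
    and add_in: "{[x, y, x + y] | x y. True} \<in> S 3"
    and mult_in: "{[x, y, x * y] | x y. True} \<in> S 3"
    \<comment> \<open>\<open>is_interval\<close> covers all intervals, bounded or not, and the singletons.\<close>
    and o_minimal: "S 1 = {(\<lambda>t. [t]) ` \<Union>\<J> | \<J>. finite \<J> \<and> (\<forall>I\<in>\<J>. is_interval I)}"

text \<open>The coordinates of a vector as a list.  \<open>from_nat_into UNIV\<close> restricts to a bijection from
  \<open>{..<CARD('n)}\<close> to the index type.  Which bijection it is does not matter, as the sets of a
  structure are closed under permutation of coordinates.\<close>

definition coords :: "real ^ 'n \<Rightarrow> real list"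
  where "coords x = map (\<lambda>i. x $ from_nat_into UNIV i) [0..<CARD('n)]"

definition definable_set :: "(nat \<Rightarrow> real list set set) \<Rightarrow> (real ^ 'n) set \<Rightarrow> bool"
  where "definable_set S A \<longleftrightarrow> coords ` A \<in> S CARD('n)"

definition definable_fun :: "(nat \<Rightarrow> real list set set) \<Rightarrow> (real \<Rightarrow> real) \<Rightarrow> bool"
  where "definable_fun S f \<longleftrightarrow> {[t, f t] | t. True} \<in> S 2"


section \<open>Multifunctions\<close>

definition definable_mf ::
    "(nat \<Rightarrow> real list set set) \<Rightarrow> (real ^ 'm \<Rightarrow> (real ^ 'n) set) \<Rightarrow> bool"
  where "definable_mf S F \<longleftrightarrow>
    {coords x @ coords y | x y. y \<in> F x} \<in> S (CARD('m) + CARD('n))"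

definition mf_dom :: "('a \<Rightarrow> 'b set) \<Rightarrow> 'a set"
  where "mf_dom F = {x. F x \<noteq> {}}"

definition mf_liminf :: "('a::topological_space \<Rightarrow> 'b::topological_space set) \<Rightarrow> 'a \<Rightarrow> 'b set"
  where "mf_liminf F b =
    {y. \<forall>xs. (\<forall>k. xs k \<in> mf_dom F - {b}) \<and> xs \<longlonglongrightarrow> b \<longrightarrow>
          (\<exists>ys. (\<forall>k. ys k \<in> F (xs k)) \<and> ys \<longlonglongrightarrow> y)}"

definition mf_limsup :: "('a::topological_space \<Rightarrow> 'b::topological_space set) \<Rightarrow> 'a \<Rightarrow> 'b set"
  where "mf_limsup F b =
    {y. \<exists>xs ys. (\<forall>k. xs k \<in> mf_dom F - {b}) \<and> xs \<longlonglongrightarrow> b \<and>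
          (\<forall>k. ys k \<in> F (xs k)) \<and> ys \<longlonglongrightarrow> y}"

text \<open>The limits are meaningful only at points of the closure of \<open>mf_dom F - {b}\<close>; at an isolated
  point of the domain continuity imposes no condition.\<close>

definition mf_continuous_at ::
    "('a::topological_space \<Rightarrow> 'b::topological_space set) \<Rightarrow> 'a \<Rightarrow> bool"
  where "mf_continuous_at F b \<longleftrightarrow>
    (b \<in> closure (mf_dom F - {b}) \<longrightarrow> mf_liminf F b = F b \<and> mf_limsup F b = F b)"

definition mf_continuous :: "('a::topological_space \<Rightarrow> 'b::topological_space set) \<Rightarrow> bool"
  where "mf_continuous F \<longleftrightarrow> (\<forall>b\<in>mf_dom F. mf_continuous_at F b)"

definition strong_preimage :: "('a \<Rightarrow> 'b set) \<Rightarrow> 'b set \<Rightarrow> 'a set"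
  where "strong_preimage F B = {x. F x = B}"

text \<open>For non-empty compact sets the suprema are attained, hence maxima.\<close>

definition hausdorff_dist :: "'a::metric_space set \<Rightarrow> 'a set \<Rightarrow> real"
  where "hausdorff_dist A B = max (SUP x\<in>A. infdist x B) (SUP x\<in>B. infdist x A)"


section \<open>The class of comparison functions\<close>

definition C_k_real :: "nat \<Rightarrow> (real \<Rightarrow> real) \<Rightarrow> bool"
  where "C_k_real k f \<longleftrightarrow>
    (\<forall>j<k. \<forall>t. (deriv ^^ j) f differentiable at t) \<and> continuous_on UNIV ((deriv ^^ k) f)"

definition Phi :: "nat \<Rightarrow> (real \<Rightarrow> real) set"
  where "Phi p = {\<phi>. (\<forall>t. \<phi> (- t) = - \<phi> t) \<and> strict_mono \<phi> \<and> bij \<phi> \<and> C_k_real p \<phi> \<and>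
    (\<forall>k\<in>{1..p}. (deriv ^^ k) \<phi> 0 = 0)}"

end

theory Submission
  imports Defs
begin

text \<open>By compactness of \<open>K\<close> and continuity of \<open>F\<close>, every \<open>t > 0\<close> has an \<open>r > 0\<close> with
  \<open>dist\<^sub>H(F(x), F(a)) \<ge> r\<close> whenever \<open>x \<in> K\<close> and \<open>d(x, F\<^sup>-\<^sup>1(F(a))) \<ge> t\<close>; the supremum \<open>g(t)\<close> of the
  \<open>r \<le> 1\<close> with this property is a positive, nondecreasing, definable minorant.  It remains to find
  a \<open>\<phi> \<in> \<Phi>\<^sub>p\<close> below \<open>g\<close>.

  A definable function that is continuous on some \<open>(0, \<epsilon>)\<close> is \<open>C\<^sup>1\<close> on a smaller interval: its
  one-sided derivatives exist by o-minimality, they are finite and agree except at finitely many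
  points by the mean value inequality, and the derivative has no jumps by the mean value theorem.
  If moreover \<open>u \<longrightarrow> 0\<close> at \<open>0\<close>, then \<open>t u'(t) \<longrightarrow> 0\<close>, whence the odd extension of \<open>t\<^sup>p u(t)\<close> is
  \<open>C\<^sup>p\<close> near \<open>0\<close> and its derivatives up to order \<open>p\<close> vanish there.  With \<open>u(t) = t g(t)\<close> and \<open>\<psi>\<close> this extension, a
  suitable \<open>\<phi>\<close> is \<open>c (1 + t\<^sup>2) \<psi>(\<delta> t / \<surd>(1 + t\<^sup>2))\<close>, for which no gluing is needed.\<close>

section \<open>Definable predicates and maps\<close>

text \<open>Definability is transported from lists to types: through the bijection
  \<open>crd\<close>, tuples of variables become elements of nested products, and formulas can be
  handled in ordinary HOL syntax with \<open>fst\<close> and \<open>snd\<close>.\<close>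

class coord =
  fixes crd :: "'a \<Rightarrow> real list" and cdim :: "'a itself \<Rightarrow> nat"
  assumes bij_crd: "bij_betw crd UNIV (points (cdim TYPE('a)))"
begin

lemma length_crd [simp]: "length (crd x) = cdim TYPE('a)"
  using bij_crd by (auto simp: bij_betw_def points_def)

lemma inj_crd: "inj crd"
  using bij_crd by (auto simp: bij_betw_def)

lemma crd_eq_iff [simp]: "crd x = crd y \<longleftrightarrow> x = y"
  using inj_crd by (auto dest: injD)

lemma range_crd: "range crd = points (cdim TYPE('a))"
  using bij_crd by (auto simp: bij_betw_def)

lemma obtain_crd:
  assumes "length xs = cdim TYPE('a)"
  obtains x where "xs = crd x"
  using assms range_crd by (auto simp: points_def)

end

instantiation real :: coord
begin

definition crd_real :: "real \<Rightarrow> real list" where "crd_real x = [x]"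
definition cdim_real :: "real itself \<Rightarrow> nat" where "cdim_real _ = 1"

instance
proof
  show "bij_betw (crd :: real \<Rightarrow> _) UNIV (points (cdim TYPE(real)))"
    by (auto simp: bij_betw_def inj_on_def points_def crd_real_def cdim_real_def length_Suc_conv)
qed

end

instantiation prod :: (coord, coord) coord
begin

definition crd_prod :: "'a \<times> 'b \<Rightarrow> real list"
  where "crd_prod z = crd (fst z) @ crd (snd z)"
definition cdim_prod :: "('a \<times> 'b) itself \<Rightarrow> nat"
  where "cdim_prod _ = cdim TYPE('a) + cdim TYPE('b)"

instance
proof
  have "inj (crd :: 'a \<times> 'b \<Rightarrow> _)"
    by (auto simp: inj_on_def crd_prod_def)
  moreover have "xs \<in> range (crd :: 'a \<times> 'b \<Rightarrow> _)" if len: "length xs = cdim TYPE('a) + cdim TYPE('b)" for xs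
  proof -
    obtain x :: 'a where x: "take (cdim TYPE('a)) xs = crd x"
    proof (rule obtain_crd)
      show "length (take (cdim TYPE('a)) xs) = cdim TYPE('a)" using len by simp
    qed
    obtain y :: 'b where y: "drop (cdim TYPE('a)) xs = crd y"
    proof (rule obtain_crd)
      show "length (drop (cdim TYPE('a)) xs) = cdim TYPE('b)" using len by simp
    qed
    have "crd (x, y) = xs"
      by (simp add: crd_prod_def flip: x y)
    then show ?thesis by (metis rangeI)
  qed
  ultimately show "bij_betw (crd :: 'a \<times> 'b \<Rightarrow> _) UNIV (points (cdim TYPE('a \<times> 'b)))"
    by (auto simp: bij_betw_def points_def crd_prod_def cdim_prod_def)
qed

end

lemma length_concat_blocks:
  "(\<And>i. i < N \<Longrightarrow> length (f i) = d) \<Longrightarrow> length (concat (map f [0..<N])) = N * d"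
  by (induction N) auto

lemma nth_concat_blocks:
  assumes "\<And>i. i < N \<Longrightarrow> length (f i) = d" "j < N" "l < d"
  shows "concat (map f [0..<N]) ! (j * d + l) = f j ! l"
  using assms
proof (induction N)
  case (Suc N)
  have len: "length (concat (map f [0..<N])) = N * d"
    by (rule length_concat_blocks) (use Suc in auto)
  show ?case
  proof (cases "j < N")
    case True
    then have "Suc j * d \<le> N * d" by (intro mult_right_mono) auto
    then have "j * d + l < N * d" using \<open>l < d\<close> by simp
    with True Suc len show ?thesis by (simp add: nth_append)
  next
    case False
    with Suc have "j = N" by simp
    with len show ?thesis by (simp add: nth_append)
  qed
qed simp

lemma concat_take_drop_blocks:
  "length xs = N * d \<Longrightarrow> concat (map (\<lambda>j. take d (drop (j * d) xs)) [0..<N]) = xs"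
proof (induction N arbitrary: xs)
  case (Suc N)
  have "concat (map (\<lambda>j. take d (drop (j * d) xs)) [0..<N])
      = concat (map (\<lambda>j. take d (drop (j * d) (take (N * d) xs))) [0..<N])"
  proof (intro arg_cong[of _ _ concat] map_cong refl)
    fix j assume "j \<in> set [0..<N]"
    then have "Suc j * d \<le> N * d" by (intro mult_right_mono) auto
    then show "take d (drop (j * d) xs) = take d (drop (j * d) (take (N * d) xs))"
      by (simp add: drop_take min_def)
  qed
  also have "\<dots> = take (N * d) xs" by (rule Suc.IH) (use Suc in auto)
  finally show ?case using Suc.prems by simp
qed simp

lemma bij_betw_from_nat_into: "bij_betw (from_nat_into UNIV) {..<CARD('n::finite)} (UNIV :: 'n set)"
  using bij_betw_from_nat_into_finite[of "UNIV :: 'n set"] by simp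

lemma obtain_index:
  obtains j where "j < CARD('n)" "(i :: 'n::finite) = from_nat_into UNIV j"
proof -
  have "i \<in> from_nat_into UNIV ` {..<CARD('n)}"
    using bij_betw_from_nat_into[where 'n='n] by (simp add: bij_betw_def)
  with that show ?thesis by auto
qed

instantiation vec :: (coord, finite) coord
begin

text \<open>The entries occupy consecutive blocks of equal length, in the index order used by
  \<open>coords\<close>; for real entries the two encodings coincide.\<close>

definition crd_vec :: "'a ^ 'b \<Rightarrow> real list"
  where "crd_vec x = concat (map (\<lambda>i. crd (x $ from_nat_into UNIV i)) [0..<CARD('b)])"
definition cdim_vec :: "('a ^ 'b) itself \<Rightarrow> nat"
  where "cdim_vec _ = CARD('b) * cdim TYPE('a)"

lemma crd_vec_nth:
  assumes "j < CARD('b)" "l < cdim TYPE('a)"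
  shows "crd (x :: 'a ^ 'b) ! (j * cdim TYPE('a) + l) = crd (x $ from_nat_into UNIV j) ! l"
  unfolding crd_vec_def by (rule nth_concat_blocks) (use assms in auto)

instance
proof
  have "inj (crd :: 'a ^ 'b \<Rightarrow> _)"
  proof (rule injI)
    fix x y :: "'a ^ 'b" assume eq: "crd x = crd y"
    show "x = y"
    proof (rule vec_eq_iff[THEN iffD2, rule_format])
      fix i :: 'b
      obtain j where j: "j < CARD('b)" "i = from_nat_into UNIV j"
        by (rule obtain_index[of i])
      have "crd (x $ i) = crd (y $ i)"
        by (rule nth_equalityI) (use j eq crd_vec_nth[OF j(1)] in \<open>auto, metis\<close>)
      then show "x $ i = y $ i" by simp
    qed
  qed
  moreover have "xs \<in> range (crd :: 'a ^ 'b \<Rightarrow> _)" if len: "length xs = CARD('b) * cdim TYPE('a)" for xs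
  proof -
    \<comment> \<open>\<open>k\<close> inverts the enumeration of the indices. The vector is rebuilt
      entry by entry, decoding the block of \<open>xs\<close> at position
      \<open>k i\<close>.\<close>
    define k where "k = the_inv_into {..<CARD('b)} (from_nat_into (UNIV :: 'b set))"
    have k: "k (from_nat_into UNIV j) = j" if "j < CARD('b)" for j
      unfolding k_def using that bij_betw_from_nat_into[where 'n='b]
      by (intro the_inv_into_f_f) (auto simp: bij_betw_def)
    define x :: "'a ^ 'b" where
      "x = (\<chi> i. inv crd (take (cdim TYPE('a)) (drop (k i * cdim TYPE('a)) xs)))"
    have "crd (x $ from_nat_into UNIV j) = take (cdim TYPE('a)) (drop (j * cdim TYPE('a)) xs)"
      if j: "j < CARD('b)" for j
    proof -
      have "Suc j * cdim TYPE('a) \<le> CARD('b) * cdim TYPE('a)"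
        using j by (intro mult_right_mono) auto
      then have "take (cdim TYPE('a)) (drop (j * cdim TYPE('a)) xs) \<in> range (crd :: 'a \<Rightarrow> _)"
        using len by (simp add: range_crd points_def)
      then show ?thesis using j by (simp add: x_def k f_inv_into_f)
    qed
    then have "crd x = concat (map (\<lambda>j. take (cdim TYPE('a)) (drop (j * cdim TYPE('a)) xs)) [0..<CARD('b)])"
      unfolding crd_vec_def by (intro arg_cong[of _ _ concat] map_cong) auto
    also have "\<dots> = xs" by (rule concat_take_drop_blocks) (rule len)
    finally show ?thesis by (metis rangeI)
  qed
  ultimately show "bij_betw (crd :: 'a ^ 'b \<Rightarrow> _) UNIV (points (cdim TYPE('a ^ 'b)))"
    by (auto simp: bij_betw_def points_def cdim_vec_def crd_vec_def intro!: length_concat_blocks)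
qed

end

lemma crd_eq_coords: "crd x = coords x"
  by (simp add: crd_vec_def coords_def crd_real_def)

lemma cdim_real_vec: "cdim TYPE(real ^ 'n) = CARD('n)"
  by (simp add: cdim_vec_def cdim_real_def)

section \<open>Closure of the family \<open>S\<close> under intersections, padding and reindexing of
  coordinates\<close>

context o_minimal_structure
begin

lemma points_in: "points n \<in> S n"
  using Compl_in[OF empty_in] by simp

lemma Int_in:
  assumes "A \<in> S n" "B \<in> S n"
  shows "A \<inter> B \<in> S n"
proof -
  have "A \<inter> B = points n - ((points n - A) \<union> (points n - B))"
    using assms subset_points by blast
  with assms show ?thesis by (simp add: Compl_in Un_in)
qed

lemma finite_Ball_in:
  assumes "finite I" "\<And>i. i \<in> I \<Longrightarrow> {xs \<in> points n. P i xs} \<in> S n"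
  shows "{xs \<in> points n. \<forall>i\<in>I. P i xs} \<in> S n"
  using assms
proof (induction I rule: finite_induct)
  case (insert i I)
  have "{xs \<in> points n. \<forall>j\<in>insert i I. P j xs}
      = {xs \<in> points n. P i xs} \<inter> {xs \<in> points n. \<forall>j\<in>I. P j xs}" by auto
  with insert show ?case by (auto intro!: Int_in)
qed (simp add: points_in)

lemma append_left_in:
  assumes "A \<in> S n"
  shows "{us @ vs | us vs. us \<in> points m \<and> vs \<in> A} \<in> S (m + n)"
proof (induction m)
  case 0
  with assms show ?case by (simp add: points_def)
next
  case (Suc m)
  have "{us @ vs | us vs. us \<in> points (Suc m) \<and> vs \<in> A}
      = {x # xs | x xs. xs \<in> {us @ vs | us vs. us \<in> points m \<and> vs \<in> A}}"
    by (auto simp: points_def length_Suc_conv) (metis append_Cons)+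
  with Cons_in[OF Suc] show ?case by simp
qed

lemma append_right_in:
  assumes "A \<in> S n"
  shows "{us @ vs | us vs. us \<in> A \<and> vs \<in> points m} \<in> S (n + m)"
proof (induction m)
  case 0
  with assms show ?case by (simp add: points_def)
next
  case (Suc m)
  have "{us @ vs | us vs. us \<in> A \<and> vs \<in> points (Suc m)}
      = {xs @ [x] | x xs. xs \<in> {us @ vs | us vs. us \<in> A \<and> vs \<in> points m}}"
    by (auto simp: points_def length_Suc_conv_rev) (metis append_assoc)+
  with snoc_in[OF Suc] show ?case by simp
qed

text \<open>The axiom \<open>diagonal_in\<close> compares only the first and the last coordinate. It
  is applied to the segment from \<open>i\<close> to \<open>j\<close>, which is then padded with
  free coordinates on both sides.\<close>

lemma nth_eq_in:
  assumes "i < n" "j < n"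
  shows "{xs \<in> points n. xs ! i = xs ! j} \<in> S n"
proof -
  have *: "{xs \<in> points n. xs ! i = xs ! j} \<in> S n" if "i \<le> j" "j < n" for i j
  proof -
    let ?D = "{xs \<in> points (Suc (j - i)). hd xs = last xs}"
    let ?E = "{us @ vs | us vs. us \<in> ?D \<and> vs \<in> points (n - Suc j)}"
    have "{us @ vs | us vs. us \<in> points i \<and> vs \<in> ?E} \<in> S (i + (Suc (j - i) + (n - Suc j)))"
      by (intro append_left_in append_right_in diagonal_in) simp
    moreover have "i + (Suc (j - i) + (n - Suc j)) = n" using that by simp
    moreover have "{us @ vs | us vs. us \<in> points i \<and> vs \<in> ?E} = {xs \<in> points n. xs ! i = xs ! j}"
      (is "?L = ?R")
    proof (intro equalityI subsetI)
      fix xs assume "xs \<in> ?L"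
      then obtain us vs ws where *: "xs = us @ vs @ ws" "length us = i" "length vs = Suc (j - i)"
        "hd vs = last vs" "length ws = n - Suc j"
        by (auto simp: points_def)
      from * have "vs \<noteq> []" by auto
      with * that show "xs \<in> ?R"
        by (auto simp: points_def nth_append hd_conv_nth last_conv_nth)
    next
      fix xs assume xs: "xs \<in> ?R"
      define vs where "vs = take (Suc (j - i)) (drop i xs)"
      have eq: "xs = take i xs @ vs @ drop (Suc j) xs"
        using that by (metis Suc_diff_le append_take_drop_id drop_drop le_SucI le_add_diff_inverse2 vs_def)
      have "vs \<noteq> []" "length vs = Suc (j - i)" using xs that by (auto simp: vs_def points_def)
      moreover have "hd vs = last vs"
        using xs that calculation by (auto simp: hd_conv_nth last_conv_nth points_def vs_def)
      ultimately have "vs @ drop (Suc j) xs \<in> ?E"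
        using xs by (force simp: points_def)
      moreover have "take i xs \<in> points i" using xs that by (auto simp: points_def)
      ultimately show "xs \<in> ?L" using eq by blast
    qed
    ultimately show ?thesis by simp
  qed
  show ?thesis
    using *[of i j] *[of j i] assms by (cases "i \<le> j") (auto simp: eq_commute)
qed

lemma take_image_in: "A \<in> S (n + k) \<Longrightarrow> take n ` A \<in> S n"
proof (induction k arbitrary: A)
  case 0
  then have "take n ` A = A"
    using subset_points by (force simp: points_def)
  with 0 show ?case by simp
next
  case (Suc k)
  have "take n ` butlast ` A \<in> S n"
    using Suc by (intro Suc.IH projection_in) simp
  moreover have "take n ` butlast ` A = take n ` A"
    unfolding image_image using Suc.prems subset_points
    by (intro image_cong) (auto simp: points_def take_butlast dest!: subset_points)
  ultimately show ?case by simp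
qed

text \<open>Adjoin a block of \<open>n\<close> coordinates lying in \<open>A\<close>, tie its
  \<open>i\<close>-th entry to coordinate \<open>\<sigma> i\<close>, and project the block away. As
  \<open>\<sigma>\<close> is arbitrary, this covers permuting, repeating and dropping coordinates at
  once.\<close>

lemma reindex_in:
  assumes A: "A \<in> S n" and \<sigma>: "\<And>i. i < n \<Longrightarrow> \<sigma> i < m"
  shows "{xs \<in> points m. map (\<lambda>i. xs ! \<sigma> i) [0..<n] \<in> A} \<in> S m"
proof -
  let ?L = "{us @ vs | us vs. us \<in> points m \<and> vs \<in> A}"
  let ?E = "{zs \<in> points (m + n). \<forall>i\<in>{..<n}. zs ! \<sigma> i = zs ! (m + i)}"
  have "?L \<inter> ?E \<in> S (m + n)"
    using \<sigma> by (intro Int_in append_left_in A finite_Ball_in nth_eq_in) (auto simp: trans_less_add1)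
  then have "take m ` (?L \<inter> ?E) \<in> S m" by (rule take_image_in)
  moreover have "take m ` (?L \<inter> ?E) = {xs \<in> points m. map (\<lambda>i. xs ! \<sigma> i) [0..<n] \<in> A}" (is "_ = ?R")
  proof (intro equalityI subsetI)
    fix xs assume "xs \<in> take m ` (?L \<inter> ?E)"
    then obtain vs where *: "xs \<in> points m" "vs \<in> A" "\<forall>i<n. (xs @ vs) ! \<sigma> i = (xs @ vs) ! (m + i)"
      by (auto simp: points_def)
    have "length vs = n" using * subset_points[OF A] by (auto simp: points_def)
    then have "map (\<lambda>i. xs ! \<sigma> i) [0..<n] = vs"
      using * \<sigma> by (auto intro!: nth_equalityI simp: nth_append points_def)
    with * show "xs \<in> ?R" by simp
  next
    fix xs assume *: "xs \<in> ?R"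
    let ?vs = "map (\<lambda>i. xs ! \<sigma> i) [0..<n]"
    have "xs @ ?vs \<in> ?L \<inter> ?E" using * \<sigma> by (auto simp: points_def nth_append)
    moreover have "take m (xs @ ?vs) = xs" using * by (auto simp: points_def)
    ultimately show "xs \<in> take m ` (?L \<inter> ?E)" by (metis (lifting) imageI)
  qed
  ultimately show ?thesis by simp
qed

section \<open>Definable predicates, definable maps and substitution\<close>

definition defp :: "('a::coord \<Rightarrow> bool) \<Rightarrow> bool"
  where "defp P \<longleftrightarrow> crd ` Collect P \<in> S (cdim TYPE('a))"

text \<open>With graphs as predicates on pairs and sets as predicates, logical connectives and
  quantifiers correspond to closure properties of \<open>S\<close>, so that definability can be
  proved by following the syntax of a formula.\<close>

definition defm :: "('a::coord \<Rightarrow> 'b::coord) \<Rightarrow> bool"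
  where "defm f \<longleftrightarrow> defp (\<lambda>z. snd z = f (fst z))"

lemma crd_image_Collect:
  "crd ` {x :: 'a::coord. P (crd x)} = {xs \<in> points (cdim TYPE('a)). P xs}"
  by (auto simp flip: range_crd)

lemma defp_not: "defp P \<Longrightarrow> defp (\<lambda>x :: 'a::coord. \<not> P x)"
proof -
  have "crd ` {x :: 'a. \<not> P x} = points (cdim TYPE('a)) - crd ` Collect P"
    by (auto simp flip: range_crd)
  then show "defp P \<Longrightarrow> ?thesis" by (simp add: defp_def Compl_in)
qed

lemma defp_disj: "defp P \<Longrightarrow> defp Q \<Longrightarrow> defp (\<lambda>x. P x \<or> Q x)"
  by (simp add: defp_def Collect_disj_eq image_Un Un_in)

lemma defp_conj: "defp P \<Longrightarrow> defp Q \<Longrightarrow> defp (\<lambda>x. P x \<and> Q x)"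
  using defp_not[OF defp_disj[OF defp_not defp_not, of P Q]] by simp

lemma defp_imp: "defp P \<Longrightarrow> defp Q \<Longrightarrow> defp (\<lambda>x. P x \<longrightarrow> Q x)"
  unfolding imp_conv_disj by (intro defp_disj defp_not)

lemma defp_True: "defp (\<lambda>x :: 'a::coord. True)"
  by (simp add: defp_def range_crd points_in)

lemma defp_const: "defp (\<lambda>x :: 'a::coord. c)"
  using defp_True defp_not[OF defp_True] by (cases c) auto

lemma defp_Ball_finite:
  assumes "finite I" "\<And>i. i \<in> I \<Longrightarrow> defp (P i)"
  shows "defp (\<lambda>x. \<forall>i\<in>I. P i x)"
  using assms by (induction I rule: finite_induct) (auto intro: defp_conj defp_const)

text \<open>Since \<open>crd\<close> of a pair is a concatenation, quantifying over the second
  component amounts to projecting the last block away.\<close>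

lemma defp_ex:
  fixes P :: "'a::coord \<Rightarrow> 'b::coord \<Rightarrow> bool"
  assumes "defp (\<lambda>z. P (fst z) (snd z))"
  shows "defp (\<lambda>x. \<exists>y. P x y)"
proof -
  have "take (cdim TYPE('a)) ` crd ` {z. P (fst z) (snd z)} \<in> S (cdim TYPE('a))"
    using assms by (intro take_image_in) (simp add: defp_def cdim_prod_def)
  moreover have "take (cdim TYPE('a)) ` crd ` {z. P (fst z) (snd z)} = crd ` {x. \<exists>y. P x y}"
    by (force simp: image_image crd_prod_def image_iff)
  ultimately show ?thesis by (simp add: defp_def)
qed

lemma defp_all:
  fixes P :: "'a::coord \<Rightarrow> 'b::coord \<Rightarrow> bool"
  assumes "defp (\<lambda>z. P (fst z) (snd z))"
  shows "defp (\<lambda>x. \<forall>y. P x y)"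
  using defp_not[OF defp_ex[of "\<lambda>x y. \<not> P x y"]] defp_not[OF assms] by simp

text \<open>Maps each of whose output coordinates is an input coordinate: projections, pairings of
  such maps, vector entries. Substitution of these comes first, because substitution of general
  definable maps needs variables to be moved about.\<close>

definition reindexing :: "('a::coord \<Rightarrow> 'b::coord) \<Rightarrow> bool"
  where "reindexing h \<longleftrightarrow> (\<exists>\<sigma>. (\<forall>i<cdim TYPE('b). \<sigma> i < cdim TYPE('a)) \<and>
    (\<forall>x. crd (h x) = map (\<lambda>i. crd x ! \<sigma> i) [0..<cdim TYPE('b)]))"

lemma reindexingI:
  fixes h :: "'a::coord \<Rightarrow> 'b::coord"
  assumes "\<And>i. i < cdim TYPE('b) \<Longrightarrow> \<sigma> i < cdim TYPE('a)"
    and "\<And>x i. i < cdim TYPE('b) \<Longrightarrow> crd (h x) ! i = crd x ! \<sigma> i"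
  shows "reindexing h"
  unfolding reindexing_def using assms
  by (intro exI[of _ \<sigma>] conjI allI nth_equalityI) auto

lemma reindexingE:
  fixes h :: "'a::coord \<Rightarrow> 'b::coord"
  assumes "reindexing h"
  obtains \<sigma> where "\<And>i. i < cdim TYPE('b) \<Longrightarrow> \<sigma> i < cdim TYPE('a)"
    "\<And>x i. i < cdim TYPE('b) \<Longrightarrow> crd (h x) ! i = crd x ! \<sigma> i"
proof -
  obtain \<sigma> where "\<forall>i<cdim TYPE('b). \<sigma> i < cdim TYPE('a)"
    "\<forall>x. crd (h x) = map (\<lambda>i. crd x ! \<sigma> i) [0..<cdim TYPE('b)]"
    using assms unfolding reindexing_def by blast
  then show thesis by (intro that[of \<sigma>]) auto
qed

lemma defp_reindexing:
  fixes h :: "'a::coord \<Rightarrow> 'b::coord"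
  assumes "reindexing h" "defp P"
  shows "defp (\<lambda>x. P (h x))"
proof -
  obtain \<sigma> where \<sigma>: "\<And>i. i < cdim TYPE('b) \<Longrightarrow> \<sigma> i < cdim TYPE('a)"
    "\<And>x. crd (h x) = map (\<lambda>i. crd x ! \<sigma> i) [0..<cdim TYPE('b)]"
    using assms(1) unfolding reindexing_def by auto
  have "{x. P (h x)} = {x. map (\<lambda>i. crd x ! \<sigma> i) [0..<cdim TYPE('b)] \<in> crd ` Collect P}"
    unfolding \<sigma>(2)[symmetric] by auto
  then have "crd ` {x. P (h x)} = {xs \<in> points (cdim TYPE('a)). map (\<lambda>i. xs ! \<sigma> i) [0..<cdim TYPE('b)] \<in> crd ` Collect P}"
    by (simp only:) (rule crd_image_Collect)
  also have "\<dots> \<in> S (cdim TYPE('a))"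
    using assms(2) \<sigma>(1) by (intro reindex_in) (auto simp: defp_def)
  finally show ?thesis by (simp add: defp_def)
qed

lemma reindexing_id: "reindexing (\<lambda>x :: 'a::coord. x)"
  by (rule reindexingI[of "\<lambda>i. i"]) auto

lemma reindexing_comp:
  fixes f :: "'a::coord \<Rightarrow> 'b::coord" and g :: "'b \<Rightarrow> 'c::coord"
  assumes "reindexing g" "reindexing f"
  shows "reindexing (\<lambda>x. g (f x))"
proof -
  obtain \<sigma> where \<sigma>: "\<And>i. i < cdim TYPE('c) \<Longrightarrow> \<sigma> i < cdim TYPE('b)"
    "\<And>x i. i < cdim TYPE('c) \<Longrightarrow> crd (g x) ! i = crd x ! \<sigma> i"
    using reindexingE[OF assms(1)] by metis
  obtain \<tau> where \<tau>: "\<And>i. i < cdim TYPE('b) \<Longrightarrow> \<tau> i < cdim TYPE('a)"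
    "\<And>x i. i < cdim TYPE('b) \<Longrightarrow> crd (f x) ! i = crd x ! \<tau> i"
    using reindexingE[OF assms(2)] by metis
  from \<sigma> \<tau> show ?thesis by (intro reindexingI[of "\<lambda>i. \<tau> (\<sigma> i)"]) auto
qed

lemma reindexing_fst: "reindexing (fst :: 'a::coord \<times> 'b::coord \<Rightarrow> 'a)"
  by (rule reindexingI[of "\<lambda>i. i"]) (auto simp: cdim_prod_def crd_prod_def nth_append)

lemma reindexing_snd: "reindexing (snd :: 'a::coord \<times> 'b::coord \<Rightarrow> 'b)"
  by (rule reindexingI[of "\<lambda>i. cdim TYPE('a) + i"]) (auto simp: cdim_prod_def crd_prod_def nth_append)

lemma reindexing_Pair:
  fixes f :: "'c::coord \<Rightarrow> 'a::coord" and g :: "'c \<Rightarrow> 'b::coord"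
  assumes "reindexing f" "reindexing g"
  shows "reindexing (\<lambda>x. (f x, g x))"
proof -
  obtain \<sigma> where \<sigma>: "\<And>i. i < cdim TYPE('a) \<Longrightarrow> \<sigma> i < cdim TYPE('c)"
    "\<And>x i. i < cdim TYPE('a) \<Longrightarrow> crd (f x) ! i = crd x ! \<sigma> i"
    using reindexingE[OF assms(1)] by metis
  obtain \<tau> where \<tau>: "\<And>i. i < cdim TYPE('b) \<Longrightarrow> \<tau> i < cdim TYPE('c)"
    "\<And>x i. i < cdim TYPE('b) \<Longrightarrow> crd (g x) ! i = crd x ! \<tau> i"
    using reindexingE[OF assms(2)] by metis
  show ?thesis
    by (rule reindexingI[of "\<lambda>i. if i < cdim TYPE('a) then \<sigma> i else \<tau> (i - cdim TYPE('a))"])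
       (auto simp: \<sigma> \<tau> cdim_prod_def crd_prod_def nth_append)
qed

lemma reindexing_vec_nth:
  "reindexing (\<lambda>x :: 'a::coord ^ 'n::finite. x $ i)"
proof -
  obtain j where j: "j < CARD('n)" "i = from_nat_into UNIV j"
    by (rule obtain_index[of i])
  have "j * cdim TYPE('a) + l < CARD('n) * cdim TYPE('a)" if "l < cdim TYPE('a)" for l
  proof -
    have "Suc j * cdim TYPE('a) \<le> CARD('n) * cdim TYPE('a)"
      using j by (intro mult_right_mono) auto
    with that show ?thesis by simp
  qed
  with j show ?thesis
    by (intro reindexingI[of "\<lambda>l. j * cdim TYPE('a) + l"]) (auto simp: crd_vec_nth cdim_vec_def)
qed

lemma defp_eq_Pair: "defp (\<lambda>z :: 'a::coord \<times> 'a. fst z = snd z)"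
proof -
  let ?n = "cdim TYPE('a)"
  let ?P = "\<lambda>xs :: real list. \<forall>i\<in>{..<?n}. xs ! i = xs ! (?n + i)"
  have "(fst z = snd z) = ?P (crd z)" for z :: "'a \<times> 'a"
    unfolding crd_eq_iff[symmetric, of "fst z"]
    by (auto simp: crd_prod_def list_eq_iff_nth_eq nth_append)
  then have "crd ` {z :: 'a \<times> 'a. fst z = snd z} = {xs \<in> points (cdim TYPE('a \<times> 'a)). ?P xs}"
    by (simp only: crd_image_Collect[of ?P])
  also have "\<dots> \<in> S (cdim TYPE('a \<times> 'a))"
    by (intro finite_Ball_in nth_eq_in) (auto simp: cdim_prod_def)
  finally show ?thesis by (simp add: defp_def)
qed

lemma defm_reindexing:
  assumes "reindexing h"
  shows "defm h"
proof -
  have "defp (\<lambda>z. fst (snd z, h (fst z)) = snd (snd z, h (fst z)))"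
    by (rule defp_reindexing[OF _ defp_eq_Pair])
       (intro reindexing_Pair reindexing_snd reindexing_comp[OF assms] reindexing_fst)
  then show ?thesis by (simp add: defm_def)
qed

text \<open>Only the graph of \<open>f\<close> is available, so \<open>P (f x)\<close> is read as:
  some \<open>y\<close> satisfies both \<open>y = f x\<close> and \<open>P y\<close>.\<close>

lemma defp_subst:
  fixes f :: "'a::coord \<Rightarrow> 'b::coord"
  assumes "defp P" "defm f"
  shows "defp (\<lambda>x. P (f x))"
proof -
  have "defp (\<lambda>x. \<exists>y. y = f x \<and> P y)"
    using assms(2) defp_reindexing[OF reindexing_snd assms(1)]
    by (intro defp_ex defp_conj) (auto simp: defm_def)
  then show ?thesis by simp
qed

lemma defm_comp:
  fixes f :: "'a::coord \<Rightarrow> 'b::coord" and g :: "'b \<Rightarrow> 'c::coord"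
  assumes "defm g" "defm f"
  shows "defm (\<lambda>x. g (f x))"
proof -
  \<comment> \<open>The variable \<open>w\<close> stands for \<open>((x, z), y)\<close>. The
    intermediate value \<open>y\<close> sits in the outer second component, where
    \<open>defp_ex\<close> quantifies; reindexings extract \<open>(x, y)\<close> here and
    \<open>(y, z)\<close> below.\<close>
  have "defp (\<lambda>w :: ('a \<times> 'c) \<times> 'b. snd (fst (fst w), snd w) = f (fst (fst (fst w), snd w)))"
    by (rule defp_reindexing[OF _ assms(2)[unfolded defm_def]])
      (intro reindexing_Pair reindexing_snd reindexing_comp[OF reindexing_fst] reindexing_fst)
  moreover have "defp (\<lambda>w :: ('a \<times> 'c) \<times> 'b. snd (snd w, snd (fst w)) = g (fst (snd w, snd (fst w))))"
    by (rule defp_reindexing[OF _ assms(1)[unfolded defm_def]])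
      (intro reindexing_Pair reindexing_snd reindexing_comp[OF reindexing_snd] reindexing_fst)
  ultimately have "defp (\<lambda>z. \<exists>y. y = f (fst z) \<and> snd z = g y)"
    by (intro defp_ex defp_conj) auto
  then show ?thesis by (simp add: defm_def)
qed

lemma defm_Pair:
  fixes f :: "'c::coord \<Rightarrow> 'a::coord" and g :: "'c \<Rightarrow> 'b::coord"
  assumes "defm f" "defm g"
  shows "defm (\<lambda>x. (f x, g x))"
proof -
  have "defp (\<lambda>w :: 'c \<times> ('a \<times> 'b). snd (fst w, fst (snd w)) = f (fst (fst w, fst (snd w))))"
    by (rule defp_reindexing[OF _ assms(1)[unfolded defm_def]])
      (intro reindexing_Pair reindexing_snd reindexing_comp[OF reindexing_fst] reindexing_fst)
  moreover have "defp (\<lambda>w :: 'c \<times> ('a \<times> 'b). snd (fst w, snd (snd w)) = g (fst (fst w, snd (snd w))))"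
    by (rule defp_reindexing[OF _ assms(2)[unfolded defm_def]])
      (intro reindexing_Pair reindexing_snd reindexing_comp[OF reindexing_snd] reindexing_fst)
  ultimately have "defp (\<lambda>w :: 'c \<times> ('a \<times> 'b). fst (snd w) = f (fst w) \<and> snd (snd w) = g (fst w))"
    by (intro defp_conj) auto
  then show ?thesis by (simp add: defm_def prod_eq_iff)
qed

section \<open>Definability of arithmetic, constants and distances\<close>

lemma defm_id: "defm (\<lambda>x :: 'a::coord. x)"
  by (intro defm_reindexing reindexing_id)

lemma defm_fst: "defm f \<Longrightarrow> defm (\<lambda>x. fst (f x))"
  by (rule defm_comp[OF defm_reindexing[OF reindexing_fst]])

lemma defm_snd: "defm f \<Longrightarrow> defm (\<lambda>x. snd (f x))"
  by (rule defm_comp[OF defm_reindexing[OF reindexing_snd]])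

lemma defm_vec_nth: "defm f \<Longrightarrow> defm (\<lambda>x. f x $ i)"
  by (rule defm_comp[OF defm_reindexing[OF reindexing_vec_nth]])

lemma defp_subst2:
  assumes "defp (\<lambda>z. P (fst z) (snd z))" "defm f" "defm g"
  shows "defp (\<lambda>x. P (f x) (g x))"
  using defp_subst[OF assms(1) defm_Pair[OF assms(2,3)]] by simp

lemma defp_eq: "defm f \<Longrightarrow> defm g \<Longrightarrow> defp (\<lambda>x. f x = g x)"
  by (rule defp_subst2[OF defp_eq_Pair])

lemma defp_less:
  fixes f g :: "'a::coord \<Rightarrow> real"
  assumes "defm f" "defm g"
  shows "defp (\<lambda>x. f x < g x)"
proof (rule defp_subst2[OF _ assms])
  have "crd ` {z :: real \<times> real. fst z < snd z} = {[x, y] | x y. x < y}"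
    by (auto simp: crd_prod_def crd_real_def image_iff)
  then show "defp (\<lambda>z :: real \<times> real. fst z < snd z)"
    using less_in by (simp add: defp_def cdim_prod_def cdim_real_def numeral_2_eq_2)
qed

lemma defp_le:
  fixes f g :: "'a::coord \<Rightarrow> real"
  shows "defm f \<Longrightarrow> defm g \<Longrightarrow> defp (\<lambda>x. f x \<le> g x)"
  using defp_not[OF defp_less, of g f] by (simp add: not_less)

lemma defm_subst2:
  assumes "defm (\<lambda>z. h (fst z) (snd z))" "defm f" "defm g"
  shows "defm (\<lambda>x. h (f x) (g x))"
  using defm_comp[OF assms(1) defm_Pair[OF assms(2,3)]] by simp

lemma defm_add:
  fixes f g :: "'a::coord \<Rightarrow> real"
  assumes "defm f" "defm g"
  shows "defm (\<lambda>x. f x + g x)"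
proof (rule defm_subst2[OF _ assms])
  have "crd ` {z :: (real \<times> real) \<times> real. snd z = fst (fst z) + snd (fst z)} = {[x, y, x + y] | x y. True}"
    by (auto simp: crd_prod_def crd_real_def image_iff)
  then show "defm (\<lambda>z :: real \<times> real. fst z + snd z)"
    using add_in by (simp add: defm_def defp_def cdim_prod_def cdim_real_def numeral_3_eq_3)
qed

lemma defm_mult:
  fixes f g :: "'a::coord \<Rightarrow> real"
  assumes "defm f" "defm g"
  shows "defm (\<lambda>x. f x * g x)"
proof (rule defm_subst2[OF _ assms])
  have "crd ` {z :: (real \<times> real) \<times> real. snd z = fst (fst z) * snd (fst z)} = {[x, y, x * y] | x y. True}"
    by (auto simp: crd_prod_def crd_real_def image_iff)
  then show "defm (\<lambda>z :: real \<times> real. fst z * snd z)"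
    using mult_in by (simp add: defm_def defp_def cdim_prod_def cdim_real_def numeral_3_eq_3)
qed

text \<open>Singletons are intervals, so o-minimality supplies the real constants;
  \<open>defm_const\<close> extends them to other types coordinate by coordinate.\<close>

lemma defp_real_eq_const: "defp (\<lambda>x :: real. x = c)"
proof -
  have "(\<lambda>t. [t]) ` \<Union> {{c}} \<in> S 1"
    unfolding o_minimal by (rule CollectI, intro exI[of _ "{{c}}"]) (auto simp: is_interval_1)
  moreover have "crd ` {x :: real. x = c} = (\<lambda>t. [t]) ` \<Union> {{c}}"
    by (auto simp: crd_real_def)
  ultimately show ?thesis by (simp add: defp_def cdim_real_def)
qed

lemma defm_const: "defm (\<lambda>x :: 'a::coord. c :: 'b::coord)"
proof -
  have "defp (\<lambda>z :: 'a \<times> 'b. \<forall>i\<in>{..<cdim TYPE('b)}. crd (snd z) ! i = crd c ! i)"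
  proof (intro defp_Ball_finite)
    fix i assume "i \<in> {..<cdim TYPE('b)}"
    then have "reindexing (\<lambda>z :: 'a \<times> 'b. crd (snd z) ! i)"
      by (intro reindexing_comp[OF _ reindexing_snd] reindexingI[of "\<lambda>_. i"])
         (auto simp: crd_real_def cdim_real_def)
    then show "defp (\<lambda>z :: 'a \<times> 'b. crd (snd z) ! i = crd c ! i)"
      by (rule defp_reindexing[OF _ defp_real_eq_const])
  qed simp
  moreover have "(snd z = c) = (\<forall>i\<in>{..<cdim TYPE('b)}. crd (snd z) ! i = crd c ! i)" for z :: "'a \<times> 'b"
    unfolding crd_eq_iff[symmetric, of "snd z"] by (auto simp: list_eq_iff_nth_eq)
  ultimately show ?thesis by (simp add: defm_def)
qed

lemma defm_uminus:
  fixes f :: "'a::coord \<Rightarrow> real"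
  shows "defm f \<Longrightarrow> defm (\<lambda>x. - f x)"
  using defm_mult[OF defm_const[of "-1"], of f] by simp

lemma defm_diff:
  fixes f g :: "'a::coord \<Rightarrow> real"
  shows "defm f \<Longrightarrow> defm g \<Longrightarrow> defm (\<lambda>x. f x - g x)"
  using defm_add[OF _ defm_uminus, of f g] by simp

lemma defm_power:
  fixes f :: "'a::coord \<Rightarrow> real"
  shows "defm f \<Longrightarrow> defm (\<lambda>x. f x ^ k)"
  by (induction k) (auto intro: defm_mult defm_const)

lemma defm_sum:
  fixes f :: "'i \<Rightarrow> 'a::coord \<Rightarrow> real"
  assumes "finite I" "\<And>i. i \<in> I \<Longrightarrow> defm (f i)"
  shows "defm (\<lambda>x. \<Sum>i\<in>I. f i x)"
  using assms by (induction I rule: finite_induct) (auto intro: defm_add defm_const)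

lemma defm_if:
  assumes "defp P" "defm f" "defm g"
  shows "defm (\<lambda>x. if P x then f x else g x)"
proof -
  have "defp (\<lambda>z. P (fst z) \<and> snd z = f (fst z) \<or> \<not> P (fst z) \<and> snd z = g (fst z))"
    using assms by (intro defp_disj defp_conj defp_not)
      (auto simp: defm_def intro: defp_subst defm_reindexing reindexing_fst)
  then show ?thesis by (auto simp: defm_def if_distrib cong: if_cong elim!: back_subst[of defp])
qed

lemmas def_intros = defp_not defp_disj defp_conj defp_imp defp_const defp_ex defp_all
  defp_less defp_le defm_fst defm_snd defm_id defm_add defm_mult
  defm_uminus defm_diff defm_power defm_vec_nth defm_const

lemma defm_abs:
  fixes f :: "'a::coord \<Rightarrow> real"
  assumes "defm f"
  shows "defm (\<lambda>x. \<bar>f x\<bar>)"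
  unfolding abs_if by (intro defm_if def_intros assms)

lemma defm_sqrt:
  fixes f :: "'a::coord \<Rightarrow> real"
  assumes "defm f" "\<And>x. 0 \<le> f x"
  shows "defm (\<lambda>x. sqrt (f x))"
proof -
  \<comment> \<open>The graph of the root is described by a polynomial condition and a sign.\<close>
  have "(snd z = sqrt (f (fst z))) = (0 \<le> snd z \<and> snd z ^ 2 = f (fst z))" for z
    using assms(2) by (auto simp: real_sqrt_unique)
  then show ?thesis
    unfolding defm_def by (simp) (intro def_intros defp_eq defm_comp[OF assms(1)])
qed

lemma defm_dist:
  fixes f g :: "'a::coord \<Rightarrow> real ^ 'n"
  assumes "defm f" "defm g"
  shows "defm (\<lambda>x. dist (f x) (g x))"
  unfolding dist_vec_def L2_set_def dist_real_def
  by (intro defm_sqrt defm_sum def_intros defm_abs assms sum_nonneg) auto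

end

section \<open>Definable functions of one variable\<close>

text \<open>If points of \<open>J\<close> accumulate at \<open>x\<close> from the right, convexity
  puts everything between \<open>x\<close> and any point of \<open>J\<close> beyond it into
  \<open>J\<close>; otherwise a right neighbourhood misses \<open>J\<close>.\<close>

lemma interval_at_right:
  fixes J :: "real set"
  assumes "is_interval J"
  shows "(\<forall>\<^sub>F t in at_right x. t \<in> J) \<or> (\<forall>\<^sub>F t in at_right x. t \<notin> J)"
proof (cases "\<forall>d>x. \<exists>t\<in>J. x < t \<and> t < d")
  case True
  then obtain b where b: "b \<in> J" "x < b" by (meson gt_ex)
  have "t \<in> J" if t: "x < t" "t < b" for t
  proof -
    obtain s where "s \<in> J" "x < s" "s < t" using True t by blast
    with b t assms show ?thesis unfolding is_interval_1 by (meson less_imp_le)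
  qed
  with b show ?thesis by (auto simp: eventually_at_right_field)
next
  case False
  then show ?thesis by (auto simp: eventually_at_right_field)
qed

section \<open>Monotonicity and mean value inequalities from one-sided local bounds\<close>

lemma mono_if_locally_right:
  fixes f :: "real \<Rightarrow> real"
  assumes cont: "continuous_on {a<..<b} f"
    and loc: "\<And>x. x \<in> {a<..<b} \<Longrightarrow> \<forall>\<^sub>F y in at_right x. f x \<le> f y"
    and xy: "a < x" "x \<le> y" "y < b"
  shows "f x \<le> f y"
proof -
  \<comment> \<open>By compactness \<open>?S\<close> has a largest point \<open>z\<close>. If
    \<open>z < y\<close>, the local hypothesis at \<open>z\<close> would produce a larger point of
    \<open>?S\<close>; hence \<open>z = y\<close>.\<close>
  let ?S = "{x..y} \<inter> f -` {f x..}"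
  have "continuous_on {x..y} f"
    by (rule continuous_on_subset[OF cont]) (use xy in auto)
  then have "closed ?S"
    by (intro continuous_closed_preimage) auto
  then have "compact ?S"
    by (meson bounded_Int bounded_closed_interval compact_eq_bounded_closed)
  moreover have "?S \<noteq> {}" using xy by auto
  ultimately obtain z where z: "z \<in> ?S" "\<And>w. w \<in> ?S \<Longrightarrow> w \<le> z"
    by (meson compact_attains_sup)
  have "z = y"
  proof (rule ccontr)
    assume "z \<noteq> y"
    then have "z < y" using z by auto
    have "\<forall>\<^sub>F w in at_right z. f z \<le> f w" using z(1) xy by (intro loc) auto
    moreover have "\<forall>\<^sub>F w in at_right z. w \<in> {z<..<y}"
      by (rule eventually_at_right_real) (rule \<open>z < y\<close>)
    ultimately have "\<forall>\<^sub>F w in at_right z. f z \<le> f w \<and> z < w \<and> w < y"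
      by eventually_elim auto
    then obtain w where w: "f z \<le> f w" "z < w" "w < y"
      using eventually_happens'[OF trivial_limit_at_right_real] by blast
    with z have "w \<in> ?S" by auto
    with z(2) w show False by fastforce
  qed
  with z show ?thesis by auto
qed

lemma mono_if_locally_left:
  fixes f :: "real \<Rightarrow> real"
  assumes cont: "continuous_on {a<..<b} f"
    and loc: "\<And>x. x \<in> {a<..<b} \<Longrightarrow> \<forall>\<^sub>F y in at_left x. f y \<le> f x"
    and xy: "a < x" "x \<le> y" "y < b"
  shows "f x \<le> f y"
proof -
  \<comment> \<open>Passing from \<open>f t\<close> to \<open>- f (- t)\<close> exchanges left and
    right and preserves monotonicity.\<close>
  have "- f (- (- y)) \<le> - f (- (- x))"
  proof (rule mono_if_locally_right[of "-b" "-a" "\<lambda>t. - f (- t)"])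
    show "continuous_on {- b<..<- a} (\<lambda>t. - f (- t))"
      by (intro continuous_intros continuous_on_compose2[OF cont]) auto
    show "\<forall>\<^sub>F s in at_right t. - f (- t) \<le> - f (- s)" if "t \<in> {- b<..<- a}" for t
      using loc[of "-t"] that by (auto simp: at_left_minus[of "-t"] eventually_filtermap)
  qed (use xy in auto)
  then show ?thesis by simp
qed

text \<open>Lower bounds for one-sided difference quotients, with the denominator cleared. The
  supremum of the admissible \<open>c\<close> is the lower right Dini derivative; for definable
  \<open>f\<close> it is the right derivative, possibly infinite.\<close>

definition slope_right :: "(real \<Rightarrow> real) \<Rightarrow> real \<Rightarrow> real \<Rightarrow> bool"
  where "slope_right f c x \<longleftrightarrow> (\<forall>\<^sub>F y in at_right x. c * (y - x) \<le> f y - f x)"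

definition slope_left :: "(real \<Rightarrow> real) \<Rightarrow> real \<Rightarrow> real \<Rightarrow> bool"
  where "slope_left f c x \<longleftrightarrow> (\<forall>\<^sub>F y in at_left x. c * (x - y) \<le> f x - f y)"

lemma eventually_at_left_less: "\<forall>\<^sub>F y in at_left x. y < (x::real)"
  using eventually_at_left_field[of "\<lambda>y. y < x" x] by (meson lt_ex)

lemma slope_right_antimono:
  assumes "slope_right f c x" "c' \<le> c"
  shows "slope_right f c' x"
  using assms(1) eventually_at_right_less[of x] unfolding slope_right_def
proof eventually_elim
  case (elim y)
  then have "c' * (y - x) \<le> c * (y - x)" using assms(2) by (intro mult_right_mono) auto
  with elim show ?case by linarith
qed

lemma slope_left_antimono:
  assumes "slope_left f c x" "c' \<le> c"
  shows "slope_left f c' x"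
  using assms(1) eventually_at_left_less[of x] unfolding slope_left_def
proof eventually_elim
  case (elim y)
  then have "c' * (x - y) \<le> c * (x - y)" using assms(2) by (intro mult_right_mono) auto
  with elim show ?case by linarith
qed

text \<open>A mean value inequality without differentiability: the local monotonicity criteria apply
  to \<open>f t - c * t\<close>.\<close>

lemma increment_ge:
  fixes f :: "real \<Rightarrow> real"
  assumes cont: "continuous_on {a<..<b} f"
    and loc: "(\<forall>x\<in>{a<..<b}. slope_right f c x) \<or> (\<forall>x\<in>{a<..<b}. slope_left f c x)"
    and xy: "a < x" "x \<le> y" "y < b"
  shows "c * (y - x) \<le> f y - f x"
proof -
  let ?g = "\<lambda>t. f t - c * t"
  have cont': "continuous_on {a<..<b} ?g"
    by (intro continuous_intros cont)
  have "?g x \<le> ?g y"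
    using loc
  proof
    assume "\<forall>x\<in>{a<..<b}. slope_right f c x"
    then show ?thesis
      by (intro mono_if_locally_right[OF cont' _ xy]) (auto simp: slope_right_def algebra_simps)
  next
    assume "\<forall>x\<in>{a<..<b}. slope_left f c x"
    then show ?thesis
      by (intro mono_if_locally_left[OF cont' _ xy]) (auto simp: slope_left_def algebra_simps)
  qed
  then show ?thesis by (simp add: algebra_simps)
qed

lemma increment_le:
  fixes f :: "real \<Rightarrow> real"
  assumes cont: "continuous_on {a<..<b} f"
    and loc: "(\<forall>x\<in>{a<..<b}. \<forall>\<^sub>F y in at_right x. f y - f x \<le> c * (y - x)) \<or>
      (\<forall>x\<in>{a<..<b}. \<forall>\<^sub>F y in at_left x. f x - f y \<le> c * (x - y))"
    and xy: "a < x" "x \<le> y" "y < b"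
  shows "f y - f x \<le> c * (y - x)"
proof -
  have "- c * (y - x) \<le> - f y - - f x"
    using loc
    by (intro increment_ge[of a b "\<lambda>t. - f t", OF _ _ xy] continuous_intros cont)
       (auto simp: slope_right_def slope_left_def algebra_simps)
  then show ?thesis by simp
qed

lemma eventually_at_left_uminus:
  fixes x :: real
  shows "(\<forall>\<^sub>F t in at_left x. P t) \<longleftrightarrow> (\<forall>\<^sub>F t in at_right (- x). P (- t))"
  by (simp add: at_left_minus[of x] eventually_filtermap)

text \<open>Slopes of \<open>f\<close> bound the difference quotients from below, slopes of
  \<open>- f\<close> from above. They are used with \<open>e / 2\<close>, since they are weak
  inequalities and the limit needs a strict one.\<close>

lemma has_real_derivative_if_slopes:
  assumes "\<And>e. e > 0 \<Longrightarrow> slope_right f (l - e) x" "\<And>e. e > 0 \<Longrightarrow> slope_left f (l - e) x"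
    and "\<And>e. e > 0 \<Longrightarrow> slope_right (\<lambda>t. - f t) (- l - e) x"
    and "\<And>e. e > 0 \<Longrightarrow> slope_left (\<lambda>t. - f t) (- l - e) x"
  shows "(f has_real_derivative l) (at x)"
proof -
  have "((\<lambda>y. (f y - f x) / (y - x)) \<longlongrightarrow> l) (at_right x)"
  proof (rule tendstoI)
    fix e :: real assume "e > 0"
    then have "e / 2 > 0" by simp
    from assms(1)[OF this] assms(3)[OF this] eventually_at_right_less[of x]
    show "\<forall>\<^sub>F y in at_right x. dist ((f y - f x) / (y - x)) l < e"
      unfolding slope_right_def
    proof eventually_elim
      case (elim y)
      then have "l - e / 2 \<le> (f y - f x) / (y - x)" "(f y - f x) / (y - x) \<le> l + e / 2"
        by (auto simp: field_simps)
      with \<open>e > 0\<close> show ?case by (simp add: dist_real_def abs_less_iff)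
    qed
  qed
  moreover have "((\<lambda>y. (f y - f x) / (y - x)) \<longlongrightarrow> l) (at_left x)"
  proof (rule tendstoI)
    fix e :: real assume "e > 0"
    then have "e / 2 > 0" by simp
    from assms(2)[OF \<open>e / 2 > 0\<close>] assms(4)[OF \<open>e / 2 > 0\<close>] eventually_at_left_less[of x]
    show "\<forall>\<^sub>F y in at_left x. dist ((f y - f x) / (y - x)) l < e"
      unfolding slope_left_def
    proof eventually_elim
      case (elim y)
      then have "l - e / 2 \<le> (f y - f x) / (y - x)" "(f y - f x) / (y - x) \<le> l + e / 2"
        by (auto simp: field_simps)
      with \<open>e > 0\<close> show ?case by (simp add: dist_real_def abs_less_iff)
    qed
  qed
  ultimately show ?thesis
    by (simp add: has_field_derivative_iff filterlim_split_at)
qed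

section \<open>Tameness of definable subsets of the line\<close>

context o_minimal_structure
begin

lemma defp_real_intervals:
  assumes "defp (P :: real \<Rightarrow> bool)"
  obtains \<J> where "finite \<J>" "\<forall>I\<in>\<J>. is_interval I" "{t. P t} = \<Union>\<J>"
proof -
  have "crd ` Collect P \<in> S 1"
    using assms by (simp add: defp_def cdim_real_def)
  then obtain \<J> where "finite \<J>" "\<forall>I\<in>\<J>. is_interval I" "crd ` Collect P = (\<lambda>t. [t]) ` \<Union>\<J>"
    unfolding o_minimal by blast
  moreover have "inj (\<lambda>t::real. [t])" by (auto intro: injI)
  ultimately show ?thesis
    using that by (auto simp: crd_real_def[abs_def] inj_image_eq_iff)
qed

text \<open>Either one of the finitely many intervals contains a right neighbourhood of
  \<open>x\<close>, or each misses one, and finitely many such neighbourhoods can be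
  intersected.\<close>

lemma defp_at_right:
  assumes "defp (P :: real \<Rightarrow> bool)"
  shows "(\<forall>\<^sub>F t in at_right x. P t) \<or> (\<forall>\<^sub>F t in at_right x. \<not> P t)"
proof -
  obtain \<J> where \<J>: "finite \<J>" "\<forall>I\<in>\<J>. is_interval I" "{t. P t} = \<Union>\<J>"
    by (rule defp_real_intervals[OF assms])
  have P: "P t \<longleftrightarrow> (\<exists>I\<in>\<J>. t \<in> I)" for t using \<J>(3) by blast
  show ?thesis
  proof (cases "\<exists>I\<in>\<J>. \<forall>\<^sub>F t in at_right x. t \<in> I")
    case True
    then show ?thesis unfolding P by (auto elim!: eventually_mono)
  next
    case False
    then have "\<forall>I\<in>\<J>. \<forall>\<^sub>F t in at_right x. t \<notin> I"
      using interval_at_right \<J>(2) by blast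
    then show ?thesis
      unfolding P by (auto simp: eventually_ball_finite_distrib \<J>(1))
  qed
qed

lemma defp_at_left:
  assumes "defp (P :: real \<Rightarrow> bool)"
  shows "(\<forall>\<^sub>F t in at_left x. P t) \<or> (\<forall>\<^sub>F t in at_left x. \<not> P t)"
  unfolding eventually_at_left_uminus
  by (rule defp_at_right) (intro defp_subst[OF assms] def_intros)

text \<open>One of the finitely many intervals is uncountable, hence has two distinct points and
  everything between them.\<close>

lemma defp_uncountable:
  assumes "defp (P :: real \<Rightarrow> bool)" "uncountable {t. P t}"
  obtains a b where "a < b" "\<forall>t\<in>{a<..<b}. P t"
proof -
  obtain \<J> where \<J>: "finite \<J>" "\<forall>I\<in>\<J>. is_interval I" "{t. P t} = \<Union>\<J>"
    by (rule defp_real_intervals[OF assms(1)])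
  have "\<exists>I\<in>\<J>. uncountable I"
  proof (rule ccontr)
    assume "\<not> ?thesis"
    then have "countable (\<Union>\<J>)"
      using \<J>(1) countable_UN[of \<J> "\<lambda>I. I"] by (auto intro: countable_finite)
    with assms(2) \<J>(3) show False by simp
  qed
  then obtain I where I: "I \<in> \<J>" "uncountable I" by blast
  then have "infinite I" by (auto dest: countable_finite)
  then obtain a where a: "a \<in> I" by fastforce
  have "I - {a} \<noteq> {}" using \<open>infinite I\<close> by (metis finite.emptyI infinite_remove)
  then obtain b where b: "b \<in> I" "b \<noteq> a" by blast
  have "t \<in> I" if "t \<in> {min a b<..<max a b}" for t
  proof -
    have "min a b \<in> I" "max a b \<in> I" using a b by (auto simp: min_def max_def)
    moreover have "min a b \<le> t" "t \<le> max a b" using that by auto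
    ultimately show ?thesis using \<J>(2) I(1) unfolding is_interval_1 by blast
  qed
  then have "P t" if "t \<in> {min a b<..<max a b}" for t
    using that I(1) \<J>(3) by blast
  moreover have "min a b < max a b" using b by auto
  ultimately show ?thesis using that by blast
qed

text \<open>A cardinality argument: countably many sets covering an interval cannot all be
  countable, and an uncountable definable set contains an interval.\<close>

lemma defp_countable_cover:
  fixes P :: "'q::countable \<Rightarrow> real \<Rightarrow> bool"
  assumes "\<And>q. defp (P q)" "a < b" "\<And>x. x \<in> {a<..<b} \<Longrightarrow> \<exists>q. P q x"
  obtains q c d where "c < d" "{c<..<d} \<subseteq> {a<..<b}" "\<forall>x\<in>{c<..<d}. P q x"
proof -
  have "{a<..<b} = (\<Union>q. {x. P q x \<and> a < x \<and> x < b})"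
    using assms(3) by auto
  moreover have "uncountable {a<..<b}"
    using assms(2) by (simp add: uncountable_open_interval)
  ultimately have "\<exists>q. uncountable {x. P q x \<and> a < x \<and> x < b}"
    using countable_UN[of "UNIV :: 'q set" "\<lambda>q. {x. P q x \<and> a < x \<and> x < b}"] by auto
  then obtain q where q: "uncountable {x. P q x \<and> a < x \<and> x < b}" by blast
  have "defp (\<lambda>x. P q x \<and> a < x \<and> x < b)" by (intro def_intros assms)
  then obtain c d where "c < d" "\<forall>t\<in>{c<..<d}. P q t \<and> a < t \<and> t < b"
    by (rule defp_uncountable[OF _ q])
  then show ?thesis by (intro that[of c d q]) auto
qed

text \<open>The way in which generic properties are proved: by the dichotomy at \<open>0\<close>, a
  definable exceptional set that does not avoid a right neighbourhood of \<open>0\<close> contains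
  one, so it suffices to refute \<open>B\<close> on every small interval.\<close>

lemma eventually_not_if_no_interval:
  assumes "defp B" "0 < \<epsilon>"
    and "\<And>c d. c < d \<Longrightarrow> {c<..<d} \<subseteq> {0<..<\<epsilon>} \<Longrightarrow> (\<And>x. x \<in> {c<..<d} \<Longrightarrow> B x) \<Longrightarrow> False"
  shows "\<forall>\<^sub>F x :: real in at_right 0. \<not> B x"
proof (rule ccontr)
  assume "\<not> ?thesis"
  then have "\<forall>\<^sub>F x in at_right 0. B x"
    using defp_at_right[OF assms(1)] by blast
  then obtain b where b: "b > 0" "\<And>x. 0 < x \<Longrightarrow> x < b \<Longrightarrow> B x"
    unfolding eventually_at_right_field by auto
  show False
    by (rule assms(3)[of 0 "min b \<epsilon>"]) (use b assms(2) in auto)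
qed

section \<open>Differentiability of definable functions near \<open>0\<close>\<close>

lemma defp_slope_right:
  assumes f: "defm f" and "defm c" "defm x"
  shows "defp (\<lambda>z :: 'a::coord. slope_right f (c z) (x z))"
proof -
  have "slope_right f c x \<longleftrightarrow> (\<exists>b. x < b \<and> (\<forall>y. x < y \<longrightarrow> y < b \<longrightarrow> c * (y - x) \<le> f y - f x))" for c x
    by (auto simp: slope_right_def eventually_at_right_field)
  then show ?thesis
    by (simp only:) (intro def_intros defm_comp[OF f] defm_comp[OF assms(2)] defm_comp[OF assms(3)])
qed

lemma defp_slope_left:
  assumes f: "defm f" and "defm c" "defm x"
  shows "defp (\<lambda>z :: 'a::coord. slope_left f (c z) (x z))"
proof -
  have "slope_left f c x \<longleftrightarrow> (\<exists>b. b < x \<and> (\<forall>y. b < y \<longrightarrow> y < x \<longrightarrow> c * (x - y) \<le> f x - f y))" for c x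
    by (auto simp: slope_left_def eventually_at_left_field)
  then show ?thesis
    by (simp only:) (intro def_intros defm_comp[OF f] defm_comp[OF assms(2)] defm_comp[OF assms(3)])
qed

text \<open>The negation of an eventual inequality is in general only a frequent one; definability
  upgrades it to the reverse inequality holding eventually.\<close>

lemma not_slope_right:
  assumes "defm f" "\<not> slope_right f c x"
  shows "\<forall>\<^sub>F y in at_right x. f y - f x \<le> c * (y - x)"
proof -
  have "defp (\<lambda>y. c * (y - x) \<le> f y - f x)"
    by (intro def_intros defm_comp[OF assms(1)])
  from defp_at_right[OF this, of x] assms(2) show ?thesis
    unfolding slope_right_def by (auto elim: eventually_mono)
qed

lemma not_slope_left:
  assumes "defm f" "\<not> slope_left f c x"
  shows "\<forall>\<^sub>F y in at_left x. f x - f y \<le> c * (x - y)"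
proof -
  have "defp (\<lambda>y. c * (x - y) \<le> f x - f y)"
    by (intro def_intros defm_comp[OF assms(1)])
  from defp_at_left[OF this, of x] assms(2) show ?thesis
    unfolding slope_left_def by (auto elim: eventually_mono)
qed

text \<open>Rules out the right derivatives plus infinity and minus infinity, in this order. On an
  interval either one would force an increment of \<open>f\<close> beyond every multiple of the
  step.\<close>

lemma eventually_slopes_right_bounded:
  assumes f: "defm f" and "0 < \<epsilon>" and cont: "continuous_on {0<..<\<epsilon>} f"
  shows "\<forall>\<^sub>F x in at_right 0. \<not> (\<forall>c. slope_right f c x)"
    and "\<forall>\<^sub>F x in at_right 0. \<not> (\<forall>c. \<not> slope_right f c x)"
proof -
  have *: False if "c < d" "{c<..<d} \<subseteq> {0<..<\<epsilon>}" and
    "(\<forall>k. \<forall>x\<in>{c<..<d}. slope_right f k x) \<or> (\<forall>k. \<forall>x\<in>{c<..<d}. \<not> slope_right f k x)" for c d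
  proof -
    define x y where "x = (2 * c + d) / 3" and "y = (c + 2 * d) / 3"
    have xy: "c < x" "x < y" "y < d" using \<open>c < d\<close> by (auto simp: x_def y_def field_simps)
    have cont': "continuous_on {c<..<d} f" by (rule continuous_on_subset[OF cont that(2)])
    \<comment> \<open>The secant slope over an inner pair of points; \<open>?s + 1\<close> and
      \<open>?s - 1\<close> are the bounds that it cannot satisfy.\<close>
    let ?s = "(f y - f x) / (y - x)"
    from that(3) show False
    proof
      assume "\<forall>k. \<forall>x\<in>{c<..<d}. slope_right f k x"
      then have "(?s + 1) * (y - x) \<le> f y - f x"
        by (intro increment_ge[OF cont']) (use xy in auto)
      with xy show False by (simp add: distrib_right)
    next
      assume "\<forall>k. \<forall>x\<in>{c<..<d}. \<not> slope_right f k x"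
      then have "f y - f x \<le> (?s - 1) * (y - x)"
        by (intro increment_le[OF cont'] disjI1) (use xy in \<open>auto intro: not_slope_right f\<close>)
      moreover have "(?s - 1) * (y - x) = f y - f x - (y - x)"
        using xy by (simp only: left_diff_distrib mult_1_left) simp
      ultimately show False using xy by linarith
    qed
  qed
  have "defp (\<lambda>x. \<forall>c. slope_right f c x)"
    by (intro def_intros defp_slope_right f)
  then show "\<forall>\<^sub>F x in at_right 0. \<not> (\<forall>c. slope_right f c x)"
    by (rule eventually_not_if_no_interval[OF _ \<open>0 < \<epsilon>\<close>]) (use * in blast)
  have "defp (\<lambda>x. \<forall>c. \<not> slope_right f c x)"
    by (intro def_intros defp_slope_right f)
  then show "\<forall>\<^sub>F x in at_right 0. \<not> (\<forall>c. \<not> slope_right f c x)"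
    by (rule eventually_not_if_no_interval[OF _ \<open>0 < \<epsilon>\<close>]) (use * in blast)
qed

text \<open>If \<open>c'\<close> is a right slope, \<open>c\<close> is not a left slope and
  \<open>c < c'\<close>, then the right derivative exceeds the left one. The two claims exclude the
  two orders.\<close>

lemma eventually_slopes_agree:
  assumes f: "defm f" and "0 < \<epsilon>" and cont: "continuous_on {0<..<\<epsilon>} f"
  shows "\<forall>\<^sub>F x in at_right 0. \<not> (\<exists>c c'. c < c' \<and> slope_right f c' x \<and> \<not> slope_left f c x)"
    and "\<forall>\<^sub>F x in at_right 0. \<not> (\<exists>c c'. c < c' \<and> slope_left f c' x \<and> \<not> slope_right f c x)"
proof -
  \<comment> \<open>A gap between the two one-sided derivatives on a whole interval would contain a fixed pair of
    rationals on a subinterval, on which the increments of \<open>f\<close> would satisfy contradictory bounds.\<close>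
  have gap: False
    if U: "\<And>q. defp (U q)" "\<And>c c' x. U c x \<Longrightarrow> c' \<le> c \<Longrightarrow> U c' x"
      and V: "\<And>q. defp (V q)" "\<And>c c' x. V c x \<Longrightarrow> c' \<le> c \<Longrightarrow> V c' x"
      and up: "\<And>q a b x y. continuous_on {a<..<b} f \<Longrightarrow> \<forall>t\<in>{a<..<b}. U q t \<Longrightarrow> a < x \<Longrightarrow> x \<le> y \<Longrightarrow> y < b
        \<Longrightarrow> q * (y - x) \<le> f y - f x"
      and lo: "\<And>q a b x y. continuous_on {a<..<b} f \<Longrightarrow> \<forall>t\<in>{a<..<b}. \<not> V q t \<Longrightarrow> a < x \<Longrightarrow> x \<le> y \<Longrightarrow> y < b
        \<Longrightarrow> f y - f x \<le> q * (y - x)"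
      and cd: "c < d" "{c<..<d} \<subseteq> {0<..<\<epsilon>}"
      and B: "\<And>x. x \<in> {c<..<d} \<Longrightarrow> \<exists>k k'. k < k' \<and> U k' x \<and> \<not> V k x"
    for U V :: "real \<Rightarrow> real \<Rightarrow> bool" and c d
  proof -
    let ?P = "\<lambda>q :: rat \<times> rat. \<lambda>x. of_rat (fst q) < (of_rat (snd q) :: real) \<and>
      U (of_rat (snd q)) x \<and> \<not> V (of_rat (fst q)) x"
    have ex: "\<exists>q. ?P q x" if x: "x \<in> {c<..<d}" for x
    proof -
      obtain k k' where k: "k < k'" "U k' x" "\<not> V k x" using B[OF x] by blast
      obtain r where r: "k < of_rat r" "of_rat r < k'" using of_rat_dense[OF k(1)] by blast
      obtain r' where r': "of_rat r < (of_rat r' :: real)" "of_rat r' < k'" using of_rat_dense[OF r(2)] by blast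
      have "U (of_rat r') x" using U(2) k r' by (meson less_imp_le)
      moreover have "\<not> V (of_rat r) x" using V(2) k r by (meson less_imp_le)
      ultimately show ?thesis using r' by (intro exI[of _ "(r, r')"]) simp
    qed
    have "defp (?P q)" for q by (intro def_intros U V)
    then obtain q a b where ab: "a < b" "{a<..<b} \<subseteq> {c<..<d}" "\<forall>x\<in>{a<..<b}. ?P q x"
      by (rule defp_countable_cover[of ?P c d, OF _ cd(1) ex])
    define x y where "x = (2 * a + b) / 3" and "y = (a + 2 * b) / 3"
    have xy: "a < x" "x < y" "y < b" using \<open>a < b\<close> by (auto simp: x_def y_def field_simps)
    have cont': "continuous_on {a<..<b} f" by (rule continuous_on_subset[OF cont]) (use ab cd in blast)
    have "of_rat (snd q) * (y - x) \<le> f y - f x"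
      using up[OF cont'] ab(3) xy by simp
    moreover have "f y - f x \<le> of_rat (fst q) * (y - x)"
      using lo[OF cont'] ab(3) xy by simp
    ultimately have "of_rat (snd q) * (y - x) \<le> of_rat (fst q) * (y - x)" by simp
    moreover have "of_rat (fst q) < (of_rat (snd q) :: real)" using bspec[OF ab(3), of x] xy by simp
    ultimately show False using xy by simp
  qed
  have "defp (\<lambda>x. \<exists>c c'. c < c' \<and> slope_right f c' x \<and> \<not> slope_left f c x)"
    by (intro def_intros defp_slope_right defp_slope_left f)
  then show "\<forall>\<^sub>F x in at_right 0. \<not> (\<exists>c c'. c < c' \<and> slope_right f c' x \<and> \<not> slope_left f c x)"
    by (rule eventually_not_if_no_interval[OF _ \<open>0 < \<epsilon>\<close>], intro gap[of "slope_right f" "slope_left f"])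
       (auto intro!: defp_slope_right defp_slope_left f def_intros increment_ge increment_le
          intro: not_slope_left slope_right_antimono slope_left_antimono)
  have "defp (\<lambda>x. \<exists>c c'. c < c' \<and> slope_left f c' x \<and> \<not> slope_right f c x)"
    by (intro def_intros defp_slope_right defp_slope_left f)
  then show "\<forall>\<^sub>F x in at_right 0. \<not> (\<exists>c c'. c < c' \<and> slope_left f c' x \<and> \<not> slope_right f c x)"
    by (rule eventually_not_if_no_interval[OF _ \<open>0 < \<epsilon>\<close>], intro gap[of "slope_left f" "slope_right f"])
       (auto intro!: defp_slope_right defp_slope_left f def_intros increment_ge increment_le
          intro: not_slope_right slope_right_antimono slope_left_antimono)
qed

lemma eventually_differentiable:
  assumes f: "defm f" and "0 < \<epsilon>" and cont: "continuous_on {0<..<\<epsilon>} f"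
  shows "\<forall>\<^sub>F x in at_right 0. (f has_real_derivative deriv f x) (at x)"
  using eventually_slopes_right_bounded[OF assms] eventually_slopes_agree[OF assms]
proof eventually_elim
  case (elim x)
  \<comment> \<open>The candidate derivative. The set of right slopes is closed downwards, and the
    bounds in \<open>elim\<close> make it nonempty and bounded above, so \<open>l\<close> separates
    right slopes from non-slopes.\<close>
  define l where "l = Sup {c. slope_right f c x}"
  obtain C where C: "\<not> slope_right f C x" using elim by blast
  have bdd: "bdd_above {c. slope_right f c x}"
  proof (rule bdd_aboveI)
    show "c \<le> C" if "c \<in> {c. slope_right f c x}" for c
      using that C slope_right_antimono[of f c x C] by fastforce
  qed
  have right: "slope_right f c x" if c: "c < l" for c
  proof -
    have "{c. slope_right f c x} \<noteq> {}" using elim(2) by blast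
    then obtain s where "slope_right f s x" "c < s"
      using c bdd unfolding l_def by (auto simp: less_cSup_iff)
    then show ?thesis by (meson less_imp_le slope_right_antimono)
  qed
  have not_right: "\<not> slope_right f c x" if "l < c" for c
    using that bdd unfolding l_def by (meson cSup_upper mem_Collect_eq not_less)
  \<comment> \<open>Agreement of the two sides is known only across a strict gap, so a value
    strictly between \<open>c\<close> and \<open>l\<close> is inserted by
    \<open>dense\<close>.\<close>
  have left: "slope_left f c x" if "c < l" for c
    using elim(3) right that dense by meson
  have not_left: "\<not> slope_left f c x" if "l < c" for c
    using elim(4) not_right that dense by meson
  have "(f has_real_derivative l) (at x)"
  proof (rule has_real_derivative_if_slopes)
    fix e :: real assume e: "e > 0"
    show "slope_right f (l - e) x" "slope_left f (l - e) x" using right left e by auto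
    \<comment> \<open>Failing slopes just above \<open>l\<close> become slopes of \<open>- f\<close>
      just below \<open>- l\<close>.\<close>
    have "\<not> slope_right f (l + e) x" "\<not> slope_left f (l + e) x" using not_right not_left e by auto
    from not_slope_right[OF f this(1)] not_slope_left[OF f this(2)]
    show "slope_right (\<lambda>t. - f t) (- l - e) x" "slope_left (\<lambda>t. - f t) (- l - e) x"
      unfolding slope_right_def slope_left_def by (auto elim!: eventually_mono simp: algebra_simps)
  qed
  then show ?case by (simp add: DERIV_imp_deriv)
qed

section \<open>Definability and continuity of derivatives, and their growth at
  \<open>0\<close>\<close>

lemma defm_deriv:
  fixes f :: "real \<Rightarrow> real"
  assumes f: "defm f"
  shows "defm (deriv f)"
proof -
  have D: "(f has_real_derivative l) (at x) \<longleftrightarrow>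
      (\<forall>e. 0 < e \<longrightarrow> (\<exists>d. 0 < d \<and> (\<forall>y. \<bar>y - x\<bar> < d \<longrightarrow> \<bar>f y - f x - l * (y - x)\<bar> \<le> e * \<bar>y - x\<bar>)))" for x l
    unfolding has_field_derivative_def has_derivative_at_alt
    by (auto simp: bounded_linear_mult_right)
  have def_D: "defp (\<lambda>z. (f has_real_derivative l z) (at (x z)))"
    if "defm l" "defm x" for l x :: "'a::coord \<Rightarrow> real"
    unfolding D by (intro def_intros defm_abs defm_comp[OF f] defm_comp[OF that(1)] defm_comp[OF that(2)])
  \<comment> \<open>Where \<open>f\<close> has no derivative, \<open>deriv f\<close> chooses from
    the empty predicate and so takes the same value \<open>SOME l. False\<close> everywhere; thus
    the graph is definable without any differentiability assumption.\<close>
  have "snd z = deriv f (fst z) \<longleftrightarrow> (f has_real_derivative snd z) (at (fst z)) \<or>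
      \<not> (\<exists>l. (f has_real_derivative l) (at (fst z))) \<and> snd z = (SOME l. False)" for z
    unfolding deriv_def
    by (smt (verit, best) DERIV_unique Eps_cong someI_ex)
  then show ?thesis
    unfolding defm_def by (simp only:) (intro def_intros def_D defp_eq)
qed

text \<open>Otherwise the dichotomy gives \<open>c \<le> f' y\<close> on a right neighbourhood.
  Every difference quotient from \<open>x\<close> is such a value by the mean value theorem, but
  these quotients tend to \<open>f' x < c\<close>.\<close>

lemma derivative_less_right:
  fixes f f' :: "real \<Rightarrow> real"
  assumes f': "defm f'" and D: "\<And>y. y \<in> {a<..<b} \<Longrightarrow> (f has_real_derivative f' y) (at y)"
    and x: "x \<in> {a<..<b}" and c: "f' x < c"
  shows "\<forall>\<^sub>F y in at_right x. f' y < c"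
proof (rule ccontr)
  assume "\<not> ?thesis"
  moreover have "defp (\<lambda>y. f' y < c)"
    by (intro def_intros f')
  ultimately have "\<forall>\<^sub>F y in at_right x. \<not> f' y < c"
    using defp_at_right by blast
  then obtain d where d: "x < d" "\<And>y. x < y \<Longrightarrow> y < d \<Longrightarrow> c \<le> f' y"
    unfolding eventually_at_right_field by (auto simp: not_less)
  have "((\<lambda>y. (f y - f x) / (y - x)) \<longlongrightarrow> f' x) (at_right x)"
    using D[OF x] filterlim_split_at by (auto simp: has_field_derivative_iff filterlim_at_split)
  then have "\<forall>\<^sub>F y in at_right x. (f y - f x) / (y - x) < c"
    using c by (rule order_tendstoD)
  moreover have "\<forall>\<^sub>F y in at_right x. y \<in> {x<..<min b d}"
    using x d by (intro eventually_at_right_real) auto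
  ultimately have "\<forall>\<^sub>F y in at_right x. False"
  proof eventually_elim
    case (elim y)
    have "\<exists>z>x. z < y \<and> f y - f x = (y - x) * f' z"
      by (rule MVT2) (use elim x D in auto)
    then obtain z where z: "x < z" "z < y" "f y - f x = (y - x) * f' z" by blast
    with elim have "f' z < c" by simp
    with d(2)[of z] z elim show False by auto
  qed
  then show False by simp
qed

lemma continuous_on_definable_derivative:
  fixes f f' :: "real \<Rightarrow> real"
  assumes f': "defm f'" and D: "\<And>y. y \<in> {a<..<b} \<Longrightarrow> (f has_real_derivative f' y) (at y)"
  shows "continuous_on {a<..<b} f'"
proof -
  \<comment> \<open>Continuity splits into upper and lower bounds on either side of
    \<open>x\<close>. The right-hand upper bound is already available; the others follow from it for
    \<open>- f\<close>, \<open>- f (- t)\<close> and \<open>f (- t)\<close>.\<close>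
  have D1: "((\<lambda>t. - f t) has_real_derivative - f' y) (at y)" if "y \<in> {a<..<b}" for y
    using D[OF that] by (auto intro: derivative_eq_intros)
  have D3: "((\<lambda>t. f (- t)) has_real_derivative - f' (- y)) (at y)" if "y \<in> {- b<..<- a}" for y
  proof -
    have "((\<lambda>t. - t) has_real_derivative - 1) (at y)" by (auto intro: derivative_eq_intros)
    moreover have "(f has_real_derivative f' (- y)) (at (- y))" using that by (intro D) auto
    ultimately show ?thesis using DERIV_chain' by fastforce
  qed
  have D2: "((\<lambda>t. - f (- t)) has_real_derivative f' (- y)) (at y)" if "y \<in> {- b<..<- a}" for y
    using DERIV_minus[OF D3[OF that]] by simp
  have "isCont f' x" if x: "x \<in> {a<..<b}" for x
  proof -
    have "(f' \<longlongrightarrow> f' x) (at_right x)"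
    proof (rule order_tendstoI)
      fix c assume "f' x < c"
      then show "\<forall>\<^sub>F y in at_right x. f' y < c" by (intro derivative_less_right[OF f' D x]) auto
    next
      fix c assume "c < f' x"
      then have "\<forall>\<^sub>F y in at_right x. - f' y < - c"
        by (intro derivative_less_right[OF defm_uminus[OF f'] D1 x]) auto
      then show "\<forall>\<^sub>F y in at_right x. c < f' y" by simp
    qed
    moreover have "(f' \<longlongrightarrow> f' x) (at_left x)"
    proof (rule order_tendstoI)
      fix c assume "f' x < c"
      then have "\<forall>\<^sub>F y in at_right (- x). f' (- y) < c"
        using x by (intro derivative_less_right[OF defm_comp[OF f' defm_uminus[OF defm_id]] D2]) auto
      then show "\<forall>\<^sub>F y in at_left x. f' y < c" by (simp add: eventually_at_left_uminus)
    next
      fix c assume "c < f' x"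
      then have "\<forall>\<^sub>F y in at_right (- x). - f' (- y) < - c"
        using x by (intro derivative_less_right[OF defm_uminus[OF defm_comp[OF f' defm_uminus[OF defm_id]]] D3]) auto
      then show "\<forall>\<^sub>F y in at_left x. c < f' y" by (simp add: eventually_at_left_uminus)
    qed
    ultimately show ?thesis by (simp add: isCont_def filterlim_split_at)
  qed
  then show ?thesis by (simp add: continuous_at_imp_continuous_on)
qed

lemma eventually_C1:
  assumes f: "defm f" and "0 < \<epsilon>" and cont: "continuous_on {0<..<\<epsilon>} f"
  obtains \<delta> where "0 < \<delta>" "\<forall>x\<in>{0<..<\<delta>}. (f has_real_derivative deriv f x) (at x)"
    "continuous_on {0<..<\<delta>} (deriv f)"
proof -
  obtain \<delta> where \<delta>: "0 < \<delta>" "\<forall>x\<in>{0<..<\<delta>}. (f has_real_derivative deriv f x) (at x)"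
    using eventually_differentiable[OF assms] by (auto simp: eventually_at_right_field)
  with that continuous_on_definable_derivative[OF defm_deriv[OF f], of 0 \<delta> f] \<delta> show ?thesis by blast
qed

text \<open>If \<open>t * f' t\<close> stayed at least \<open>e\<close>, the mean value theorem on
  \<open>[t/2, t]\<close> would give an increment of \<open>u\<close> of at least
  \<open>e / 2\<close>, whereas both end values are below \<open>e / 4\<close> in modulus. A
  separate \<open>f'\<close> allows the use for \<open>- u\<close>.\<close>

lemma tendsto_mult_derivative_aux:
  fixes u f' :: "real \<Rightarrow> real"
  assumes f': "defm f'" and D: "\<And>t. t \<in> {0<..<\<delta>} \<Longrightarrow> (u has_real_derivative f' t) (at t)"
    and "0 < \<delta>" and lim: "(u \<longlongrightarrow> 0) (at_right 0)" and "0 < e"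
  shows "\<forall>\<^sub>F t in at_right 0. t * f' t < e"
proof (rule ccontr)
  assume "\<not> ?thesis"
  moreover have "defp (\<lambda>t. t * f' t < e)"
    by (intro def_intros f')
  ultimately have "\<forall>\<^sub>F t in at_right 0. \<not> t * f' t < e"
    using defp_at_right by blast
  moreover have "\<forall>\<^sub>F t in at_right 0. \<bar>u t\<bar> < e / 4"
    using tendstoD[OF lim, of "e / 4"] \<open>0 < e\<close> by (simp add: dist_real_def)
  moreover have "\<forall>\<^sub>F t in at_right 0. t < \<delta>"
    using eventually_at_right_real[OF \<open>0 < \<delta>\<close>] by (auto elim: eventually_mono)
  ultimately have "\<forall>\<^sub>F t in at_right 0. \<not> t * f' t < e \<and> \<bar>u t\<bar> < e / 4 \<and> t < \<delta>"
    by eventually_elim auto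
  then obtain d where d: "0 < d" and
    P: "\<And>t. 0 < t \<Longrightarrow> t < d \<Longrightarrow> e \<le> t * f' t \<and> \<bar>u t\<bar> < e / 4 \<and> t < \<delta>"
    unfolding eventually_at_right_field by (auto simp: not_less)
  define t where "t = d / 2"
  have t: "0 < t" "t < d" using d by (auto simp: t_def)
  have "\<exists>z>t / 2. z < t \<and> u t - u (t / 2) = (t - t / 2) * f' z"
    by (rule MVT2) (use t P[of t] in \<open>auto intro!: D\<close>)
  then obtain z where z: "t / 2 < z" "z < t" "u t - u (t / 2) = (t / 2) * f' z" by auto
  have "e \<le> z * f' z" using P[of z] z t by auto
  also have "\<dots> \<le> t * f' z"
    using z t \<open>e \<le> z * f' z\<close> \<open>0 < e\<close>
    by (intro mult_right_mono) (auto simp: zero_less_mult_iff dest: less_le_trans)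
  finally have "e / 2 \<le> u t - u (t / 2)" using z(3) by simp
  moreover have "\<bar>u t\<bar> < e / 4" "\<bar>u (t / 2)\<bar> < e / 4" using P[of t] P[of "t / 2"] t by auto
  ultimately show False by linarith
qed

lemma tendsto_mult_derivative:
  assumes u: "defm u" and D: "\<And>t. t \<in> {0<..<\<delta>} \<Longrightarrow> (u has_real_derivative deriv u t) (at t)"
    and "0 < \<delta>" and lim: "(u \<longlongrightarrow> 0) (at_right 0)"
  shows "((\<lambda>t. t * deriv u t) \<longlongrightarrow> 0) (at_right 0)"
proof (rule order_tendstoI)
  fix e :: real assume "0 < e"
  show "\<forall>\<^sub>F t in at_right 0. t * deriv u t < e"
    by (rule tendsto_mult_derivative_aux[OF defm_deriv[OF u] D \<open>0 < \<delta>\<close> lim \<open>0 < e\<close>]) auto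
next
  fix e :: real assume "e < 0"
  have "\<forall>\<^sub>F t in at_right 0. t * - deriv u t < - e"
  proof (rule tendsto_mult_derivative_aux)
    show "((\<lambda>t. - u t) has_real_derivative - deriv u t) (at t)" if "t \<in> {0<..<\<delta>}" for t
      using D[OF that] by (auto intro: derivative_eq_intros)
    show "((\<lambda>t. - u t) \<longlongrightarrow> 0) (at_right 0)"
      using tendsto_minus[OF lim] by simp
  qed (use \<open>e < 0\<close> \<open>0 < \<delta>\<close> in \<open>auto intro: defm_uminus defm_deriv u\<close>)
  then show "\<forall>\<^sub>F t in at_right 0. e < t * deriv u t" by simp
qed

end

section \<open>Flat functions\<close>

text \<open>On an open set \<open>X\<close>: \<open>f\<close> is of class \<open>C\<^sup>k\<close> and its derivatives of orders \<open>0, \<dots>, k\<close> vanish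
  on \<open>Z\<close>.\<close>

fun Ck_on :: "real set \<Rightarrow> real set \<Rightarrow> nat \<Rightarrow> (real \<Rightarrow> real) \<Rightarrow> bool" where
  "Ck_on X Z 0 f \<longleftrightarrow> (\<forall>z\<in>Z. f z = 0) \<and> continuous_on X f"
| "Ck_on X Z (Suc k) f \<longleftrightarrow> (\<forall>z\<in>Z. f z = 0) \<and>
    (\<exists>f'. (\<forall>x\<in>X. (f has_real_derivative f' x) (at x)) \<and> Ck_on X Z k f')"

section \<open>Calculus of \<open>Ck_on\<close>: sums, products and compositions\<close>

lemma Ck_on_zero: "Ck_on X Z k f \<Longrightarrow> z \<in> Z \<Longrightarrow> f z = 0"
  by (cases k) auto

lemma Ck_on_SucD: "Ck_on X Z (Suc k) f \<Longrightarrow> Ck_on X Z k f"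
proof (induction k arbitrary: f)
  case 0
  then obtain f' where "\<forall>x\<in>X. (f has_real_derivative f' x) (at x)" by auto
  then have "continuous_on X f" by (intro continuous_at_imp_continuous_on) (blast intro: DERIV_isCont)
  with 0 show ?case by simp
next
  case (Suc k)
  then obtain f' where "\<forall>x\<in>X. (f has_real_derivative f' x) (at x)" "Ck_on X Z (Suc k) f'" by auto
  with Suc.IH[of f'] Suc.prems show ?case by (auto simp del: Ck_on.simps) (auto intro!: exI[of _ f'])
qed

lemma Ck_on_subset: "Ck_on X Z k f \<Longrightarrow> Y \<subseteq> X \<Longrightarrow> Ck_on Y Z k f"
proof (induction k arbitrary: f)
  case 0
  then show ?case by (auto intro: continuous_on_subset)
next
  case (Suc k)
  then obtain f' where "\<forall>x\<in>X. (f has_real_derivative f' x) (at x)" "Ck_on X Z k f'" by auto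
  with Suc show ?case by (auto intro!: exI[of _ f'])
qed

lemma Ck_on_add: "Ck_on X Z k f \<Longrightarrow> Ck_on X Z k g \<Longrightarrow> Ck_on X Z k (\<lambda>x. f x + g x)"
proof (induction k arbitrary: f g)
  case 0
  then show ?case by (auto intro: continuous_intros)
next
  case (Suc k)
  then obtain f' g' where
    "\<forall>x\<in>X. (f has_real_derivative f' x) (at x)" "Ck_on X Z k f'"
    "\<forall>x\<in>X. (g has_real_derivative g' x) (at x)" "Ck_on X Z k g'"
    by auto
  with Suc show ?case
    by (auto intro!: exI[of _ "\<lambda>x. f' x + g' x"] derivative_eq_intros)
qed

text \<open>Only \<open>f\<close> has to be flat on \<open>Z\<close>: each term of the product rule
  retains \<open>f\<close> or its derivative as a factor.\<close>

lemma Ck_on_mult: "Ck_on X Z k f \<Longrightarrow> Ck_on X {} k g \<Longrightarrow> Ck_on X Z k (\<lambda>x. f x * g x)"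
proof (induction k arbitrary: f g)
  case 0
  then show ?case by (auto intro: continuous_intros)
next
  case (Suc k)
  then obtain f' g' where *:
    "\<forall>x\<in>X. (f has_real_derivative f' x) (at x)" "Ck_on X Z k f'"
    "\<forall>x\<in>X. (g has_real_derivative g' x) (at x)" "Ck_on X {} k g'"
    by auto
  have "Ck_on X Z k f" "Ck_on X {} k g" using Suc.prems by (auto intro: Ck_on_SucD simp del: Ck_on.simps)
  then have "Ck_on X Z k (\<lambda>x. f' x * g x + f x * g' x)"
    using * by (intro Ck_on_add Suc.IH)
  moreover have "\<forall>x\<in>X. ((\<lambda>x. f x * g x) has_real_derivative f' x * g x + f x * g' x) (at x)"
    using * by (auto intro!: derivative_eq_intros)
  moreover have "\<forall>z\<in>Z. f z * g z = 0" using Suc.prems by simp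
  ultimately show ?case by auto
qed

text \<open>The outer function carries the flatness: each chain rule term contains a derivative of
  \<open>f\<close> at \<open>g x\<close>, which vanishes once \<open>g x\<close> lies in
  \<open>Z\<close>.\<close>

lemma Ck_on_compose:
  "Ck_on X Z k f \<Longrightarrow> Ck_on Y {} k g \<Longrightarrow> g ` Y \<subseteq> X \<Longrightarrow> g ` W \<subseteq> Z \<Longrightarrow> Ck_on Y W k (\<lambda>x. f (g x))"
proof (induction k arbitrary: f)
  case 0
  then show ?case by (auto intro: continuous_on_compose2)
next
  case (Suc k)
  then obtain f' g' where *:
    "\<forall>x\<in>X. (f has_real_derivative f' x) (at x)" "Ck_on X Z k f'"
    "\<forall>x\<in>Y. (g has_real_derivative g' x) (at x)" "Ck_on Y {} k g'"
    by auto
  have "Ck_on Y {} k g" using Suc.prems(2) by (rule Ck_on_SucD)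
  then have "Ck_on Y W k (\<lambda>x. f' (g x) * g' x)"
    using * Suc by (intro Ck_on_mult Suc.IH)
  moreover have "\<forall>x\<in>Y. ((\<lambda>x. f (g x)) has_real_derivative f' (g x) * g' x) (at x)"
    using * Suc.prems(3) by (intro ballI DERIV_chain2[of f]) auto
  moreover have "\<forall>z\<in>W. f (g z) = 0" using Suc.prems by auto
  ultimately show ?case by auto
qed

lemma Ck_on_const: "Ck_on X {} k (\<lambda>x. c)"
  by (induction k arbitrary: c) (auto intro!: exI[of _ "\<lambda>x. 0"])

lemma Ck_on_id: "Ck_on X {} k (\<lambda>x. x)"
  by (cases k) (auto intro!: exI[of _ "\<lambda>x. 1"] Ck_on_const)

text \<open>On the whole line the witnesses in \<open>Ck_on\<close> are forced to be
  \<open>deriv\<close>, so the recursion unrolls to iterated derivatives.\<close>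

lemma C_k_real_if_Ck_on:
  "Ck_on UNIV Z k f \<Longrightarrow> C_k_real k f \<and> (\<forall>j\<le>k. \<forall>z\<in>Z. (deriv ^^ j) f z = 0)"
proof (induction k arbitrary: f)
  case 0
  then show ?case by (simp add: C_k_real_def)
next
  case (Suc k)
  then obtain f' where f': "\<And>x. (f has_real_derivative f' x) (at x)" "Ck_on UNIV Z k f'" by auto
  have "f' = deriv f" using f'(1) by (intro ext DERIV_imp_deriv[symmetric])
  with f' Suc.IH have IH: "C_k_real k (deriv f)" "\<forall>j\<le>k. \<forall>z\<in>Z. (deriv ^^ j) (deriv f) z = 0" by auto
  have "(deriv ^^ j) f differentiable at t" if "j < Suc k" for j t
  proof (cases j)
    case 0
    then show ?thesis using f'(1) by (auto simp: real_differentiable_def)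
  next
    case (Suc i)
    with that IH(1) show ?thesis by (simp add: C_k_real_def funpow_Suc_right del: funpow.simps)
  qed
  moreover have "continuous_on UNIV ((deriv ^^ Suc k) f)"
    using IH(1) by (simp add: C_k_real_def funpow_Suc_right del: funpow.simps)
  moreover have "(deriv ^^ j) f z = 0" if "j \<le> Suc k" "z \<in> Z" for j z
  proof (cases j)
    case 0
    then show ?thesis using Suc.prems that by simp
  next
    case (Suc i)
    with that IH(2) show ?thesis by (simp add: funpow_Suc_right del: funpow.simps)
  qed
  ultimately show ?case by (auto simp: C_k_real_def)
qed

text \<open>For \<open>s = -1\<close> this is the odd and for \<open>s = 1\<close> the even
  extension of the values on the positive axis, with value \<open>0\<close> at \<open>0\<close>.
  Differentiation changes \<open>s\<close> to \<open>- s\<close>, hence the parameter.\<close>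

definition reflect :: "real \<Rightarrow> (real \<Rightarrow> real) \<Rightarrow> real \<Rightarrow> real"
  where "reflect s f t = (if 0 < t then f t else if t < 0 then s * f (- t) else 0)"

lemma reflect_tendsto_0:
  assumes "(f \<longlongrightarrow> 0) (at_right 0)"
  shows "(reflect s f \<longlongrightarrow> 0) (at 0)"
proof -
  have "(reflect s f \<longlongrightarrow> 0) (at_right 0)"
    by (rule Lim_transform_eventually[OF assms])
       (use eventually_at_right_less[of 0] in \<open>auto elim!: eventually_mono simp: reflect_def\<close>)
  moreover have "((\<lambda>t. s * f t) \<longlongrightarrow> 0) (at_right 0)"
    using tendsto_mult_left[OF assms, of s] by simp
  then have "((\<lambda>t. reflect s f (- t)) \<longlongrightarrow> 0) (at_right 0)"
    by (rule Lim_transform_eventually)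
       (use eventually_at_right_less[of 0] in \<open>auto elim!: eventually_mono simp: reflect_def\<close>)
  then have "(reflect s f \<longlongrightarrow> 0) (at_left 0)"
    by (simp add: at_left_minus[of 0] filterlim_filtermap)
  ultimately show ?thesis by (simp add: filterlim_split_at)
qed

lemma reflect_continuous_on:
  assumes "continuous_on {0<..<\<delta>} f" "(f \<longlongrightarrow> 0) (at_right 0)"
  shows "continuous_on {-\<delta><..<\<delta>} (reflect s f)"
proof (rule continuous_at_imp_continuous_on, rule ballI)
  fix x assume x: "x \<in> {-\<delta><..<\<delta>}"
  have f: "isCont f y" if "y \<in> {0<..<\<delta>}" for y
    using assms(1) that by (simp add: continuous_on_eq_continuous_at)
  consider "0 < x" | "x < 0" | "x = 0" by linarith
  then show "isCont (reflect s f) x"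
  proof cases
    case 1
    have "\<forall>\<^sub>F t in nhds x. reflect s f t = f t"
      using eventually_nhds_in_open[of "{0<..}" x] 1
      by (auto elim!: eventually_mono simp: reflect_def)
    with f[of x] 1 x show ?thesis by (auto simp: isCont_cong)
  next
    case 2
    have "\<forall>\<^sub>F t in nhds x. reflect s f t = s * f (- t)"
      using eventually_nhds_in_open[of "{..<0}" x] 2
      by (auto elim!: eventually_mono simp: reflect_def)
    moreover have "isCont (\<lambda>t. s * f (- t)) x"
      using x 2 by (intro continuous_intros isCont_o2[of x uminus f] f) auto
    ultimately show ?thesis by (auto simp: isCont_cong)
  next
    case 3
    with reflect_tendsto_0[OF assms(2)] show ?thesis by (simp add: isCont_def reflect_def)
  qed
qed

lemma reflect_has_derivative:
  assumes D: "\<And>t. t \<in> {0<..<\<delta>} \<Longrightarrow> (f has_real_derivative f' t) (at t)"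
    and lim: "((\<lambda>t. f t / t) \<longlongrightarrow> 0) (at_right 0)"
    and x: "x \<in> {-\<delta><..<\<delta>}"
  shows "(reflect s f has_real_derivative reflect (- s) f' x) (at x)"
proof -
  consider "0 < x" | "x < 0" | "x = 0" by linarith
  then show ?thesis
  proof cases
    case 1
    have "\<forall>\<^sub>F t in nhds x. f t = reflect s f t"
      using eventually_nhds_in_open[of "{0<..}" x] 1
      by (auto elim!: eventually_mono simp: reflect_def)
    moreover have "(f has_real_derivative f' x) (at x)" using D 1 x by simp
    ultimately have "(reflect s f has_real_derivative f' x) (at x)"
      by (simp add: DERIV_cong_ev)
    with 1 show ?thesis by (simp add: reflect_def)
  next
    case 2
    have "\<forall>\<^sub>F t in nhds x. reflect s f t = s * f (- t)"
      using eventually_nhds_in_open[of "{..<0}" x] 2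
      by (auto elim!: eventually_mono simp: reflect_def)
    moreover have "((\<lambda>t. f (- t)) has_real_derivative f' (- x) * - 1) (at x)"
      by (rule DERIV_chain2[of f _ uminus]) (use x 2 in \<open>auto intro!: D derivative_eq_intros\<close>)
    then have "((\<lambda>t. s * f (- t)) has_real_derivative - s * f' (- x)) (at x)"
      by (auto intro!: derivative_eq_intros)
    ultimately have "(reflect s f has_real_derivative - s * f' (- x)) (at x)"
      by (simp add: DERIV_cong_ev)
    with 2 show ?thesis by (simp add: reflect_def)
  next
    case 3
    \<comment> \<open>At \<open>0\<close> the difference quotient is again a reflection, so one
      limit from the right settles both sides and the derivative is \<open>0\<close>.\<close>
    have "(\<lambda>t. reflect s f t / t) = reflect (- s) (\<lambda>t. f t / t)"
      by (auto simp: reflect_def fun_eq_iff)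
    with reflect_tendsto_0[OF lim, of "- s"]
    have "((\<lambda>t. reflect s f t / t) \<longlongrightarrow> 0) (at 0)" by simp
    with 3 show ?thesis by (simp add: has_field_derivative_iff reflect_def)
  qed
qed

context o_minimal_structure
begin

text \<open>The derivative of \<open>t\<^sup>k\<^sup>+\<^sup>1 u\<close> is \<open>t\<^sup>k ((k + 1) u + t u')\<close>, and \<open>(k + 1) u + t u'\<close> is again
  definable and tends to \<open>0\<close>, so that the induction closes.\<close>

lemma flat_reflect_power_mult:
  assumes "defm u" "0 < \<epsilon>" "continuous_on {0<..<\<epsilon>} u" "(u \<longlongrightarrow> 0) (at_right 0)"
  shows "\<exists>\<delta>>0. \<forall>s. Ck_on {-\<delta><..<\<delta>} {0} k (reflect s (\<lambda>t. t ^ k * u t))"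
  using assms
proof (induction k arbitrary: u \<epsilon>)
  case 0
  then show ?case by (auto intro!: exI[of _ \<epsilon>] reflect_continuous_on simp: reflect_def[of _ _ 0])
next
  case (Suc k)
  obtain \<delta> where \<delta>: "0 < \<delta>" "\<forall>x\<in>{0<..<\<delta>}. (u has_real_derivative deriv u x) (at x)"
    "continuous_on {0<..<\<delta>} (deriv u)"
    by (rule eventually_C1[OF Suc.prems(1-3)])
  let ?v = "\<lambda>t. real (Suc k) * u t + t * deriv u t"
  have "((\<lambda>t. t * deriv u t) \<longlongrightarrow> 0) (at_right 0)"
    by (rule tendsto_mult_derivative[OF Suc.prems(1) _ \<delta>(1) Suc.prems(4)]) (use \<delta>(2) in auto)
  from tendsto_add[OF tendsto_mult_left[OF Suc.prems(4), of "real (Suc k)"] this]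
  have lim_v: "(?v \<longlongrightarrow> 0) (at_right 0)" by simp
  have cont_u: "continuous_on {0<..<\<delta>} u"
    using \<delta>(2) by (intro continuous_at_imp_continuous_on ballI DERIV_isCont) auto
  have "\<exists>\<delta>>0. \<forall>s. Ck_on {-\<delta><..<\<delta>} {0} k (reflect s (\<lambda>t. t ^ k * ?v t))"
    by (rule Suc.IH[OF _ \<delta>(1) _ lim_v])
       (intro def_intros Suc.prems(1) defm_deriv continuous_intros cont_u \<delta>(3))+
  then obtain \<delta>' where \<delta>': "0 < \<delta>'"
    "\<And>s. Ck_on {-\<delta>'<..<\<delta>'} {0} k (reflect s (\<lambda>t. t ^ k * ?v t))" by auto
  define \<eta> where "\<eta> = min \<delta> \<delta>'"
  have D: "((\<lambda>t. t ^ Suc k * u t) has_real_derivative t ^ k * ?v t) (at t)" if "t \<in> {0<..<\<eta>}" for t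
  proof -
    have "(u has_real_derivative deriv u t) (at t)" using \<delta>(2) that by (auto simp: \<eta>_def)
    then have "((\<lambda>t. t ^ Suc k * u t) has_real_derivative
        real (Suc k) * t ^ k * u t + t ^ Suc k * deriv u t) (at t)"
      by (auto intro!: derivative_eq_intros simp del: of_nat_Suc power_Suc)
    then show ?thesis by (simp add: algebra_simps)
  qed
  \<comment> \<open>Division by \<open>t\<close> lowers the exponent by one. The limit also holds
    for \<open>k = 0\<close>, because \<open>u\<close> itself tends to \<open>0\<close>.\<close>
  have "((\<lambda>t. t ^ k * u t) \<longlongrightarrow> 0 ^ k * 0) (at_right 0)"
    by (intro tendsto_intros Suc.prems(4))
  then have "((\<lambda>t. t ^ k * u t) \<longlongrightarrow> 0) (at_right 0)" by simp
  then have lim: "((\<lambda>t. t ^ Suc k * u t / t) \<longlongrightarrow> 0) (at_right 0)"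
    by (rule Lim_transform_eventually) (rule eventually_mono[OF eventually_at_right_less], simp)
  have "Ck_on {-\<eta><..<\<eta>} {0} (Suc k) (reflect s (\<lambda>t. t ^ Suc k * u t))" for s
    unfolding Ck_on.simps
  proof (intro conjI exI ballI)
    show "(reflect s (\<lambda>t. t ^ Suc k * u t) has_real_derivative
        reflect (- s) (\<lambda>t. t ^ k * ?v t) x) (at x)" if "x \<in> {-\<eta><..<\<eta>}" for x
      by (rule reflect_has_derivative[OF D lim that])
    show "Ck_on {-\<eta><..<\<eta>} {0} k (reflect (- s) (\<lambda>t. t ^ k * ?v t))"
      by (rule Ck_on_subset[OF \<delta>'(2)]) (auto simp: \<eta>_def)
  qed (auto simp: reflect_def)
  moreover have "\<eta> > 0" using \<delta>(1) \<delta>'(1) by (simp add: \<eta>_def)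
  ultimately show ?case by blast
qed

text \<open>A monotone function has only countably many discontinuities, so they cannot fill an
  interval.\<close>

lemma eventually_continuous_if_mono:
  assumes g: "defm g" and mono: "mono_on {0<..} g"
  shows "\<exists>\<epsilon>>0. continuous_on {0<..<\<epsilon>} (g :: real \<Rightarrow> real)"
proof -
  have "isCont g x \<longleftrightarrow> (\<forall>e. 0 < e \<longrightarrow> (\<exists>d. 0 < d \<and> (\<forall>y. \<bar>y - x\<bar> < d \<longrightarrow> \<bar>g y - g x\<bar> < e)))" for x
    by (simp add: continuous_at_eps_delta dist_real_def)
  then have "defp (\<lambda>x. \<not> isCont g x)"
    by (simp only:) (intro def_intros defm_abs defm_comp[OF g])
  then have "\<forall>\<^sub>F x in at_right 0. \<not> \<not> isCont g x"
  proof (rule eventually_not_if_no_interval[OF _ zero_less_one])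
    fix c d :: real assume cd: "c < d" "{c<..<d} \<subseteq> {0<..<1}" and disc: "\<And>x. x \<in> {c<..<d} \<Longrightarrow> \<not> isCont g x"
    have "{c<..<d} \<subseteq> {x \<in> {0<..}. \<not> continuous (at x within {0<..}) g}"
    proof
      fix x assume x: "x \<in> {c<..<d}"
      then have "x \<in> {0<..}" using cd(2) by force
      then show "x \<in> {x \<in> {0<..}. \<not> continuous (at x within {0<..}) g}"
        using disc[OF x] at_within_open[of x "{0<..}"] by simp
    qed
    then have "countable {c<..<d}"
      using mono_on_ctble_discont[OF mono] by (rule countable_subset)
    with cd(1) show False using uncountable_open_interval[of c d] by simp
  qed
  then obtain \<epsilon> where "\<epsilon> > 0" "\<And>x. 0 < x \<Longrightarrow> x < \<epsilon> \<Longrightarrow> isCont g x"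
    by (auto simp: eventually_at_right_field)
  then show ?thesis by (auto intro!: exI[of _ \<epsilon>] continuous_at_imp_continuous_on)
qed

lemma defm_inverse:
  fixes f :: "'a::coord \<Rightarrow> real"
  assumes "defm f" "\<And>x. 0 < f x"
  shows "defm (\<lambda>x. inverse (f x))"
proof -
  have "(snd z = inverse (f (fst z))) = (snd z * f (fst z) = 1)" for z
    using assms(2)[of "fst z"] by (auto simp: field_simps)
  then show ?thesis
    unfolding defm_def by simp (intro def_intros defp_eq defm_comp[OF assms(1)])
qed

end

text \<open>No nonconstant rational function is bounded and monotone on the line, hence the square root.\<close>

definition squash :: "real \<Rightarrow> real"
  where "squash t = t * inverse (sqrt (1 + t\<^sup>2))"

lemma sqrt_1_plus_square_pos: "0 < sqrt (1 + t\<^sup>2)" for t :: real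
  by (simp add: add_pos_nonneg)

lemma DERIV_inverse_sqrt:
  "((\<lambda>t. inverse (sqrt (1 + t\<^sup>2))) has_real_derivative - t * inverse (sqrt (1 + t\<^sup>2)) ^ 3) (at t)"
proof -
  let ?r = "inverse (sqrt (1 + t\<^sup>2))"
  have "((\<lambda>t. 1 + t\<^sup>2) has_real_derivative 2 * t) (at t)"
    by (auto intro!: derivative_eq_intros)
  from DERIV_chain2[OF DERIV_real_sqrt this]
  have "((\<lambda>t. sqrt (1 + t\<^sup>2)) has_real_derivative ?r / 2 * (2 * t)) (at t)"
    by (simp add: add_pos_nonneg)
  from DERIV_inverse'[OF this] sqrt_1_plus_square_pos[of t]
  have "((\<lambda>t. inverse (sqrt (1 + t\<^sup>2))) has_real_derivative - (?r * (?r / 2 * (2 * t)) * ?r)) (at t)"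
    by (metis less_irrefl)
  moreover have "- (?r * (?r / 2 * (2 * t)) * ?r) = - t * ?r ^ 3"
    by (simp add: power3_eq_cube)
  ultimately show ?thesis by (simp only:)
qed

text \<open>The derivative is a polynomial in \<open>t\<close> and the function itself, so the
  induction closes.\<close>

lemma Ck_on_inverse_sqrt: "Ck_on UNIV {} k (\<lambda>t. inverse (sqrt (1 + t\<^sup>2)))"
proof (induction k)
  case 0
  show ?case by (auto intro!: continuous_at_imp_continuous_on DERIV_isCont[OF DERIV_inverse_sqrt])
next
  case (Suc k)
  let ?r = "\<lambda>t :: real. inverse (sqrt (1 + t\<^sup>2))"
  have "Ck_on UNIV {} k (\<lambda>t. (-1 * t) * (?r t * (?r t * ?r t)))"
    by (intro Ck_on_mult Ck_on_const Ck_on_id Suc)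
  also have "(\<lambda>t. (-1 * t) * (?r t * (?r t * ?r t))) = (\<lambda>t. - t * ?r t ^ 3)"
    by (simp add: fun_eq_iff power3_eq_cube)
  finally show ?case
    unfolding Ck_on.simps
    by (intro conjI ballI exI[of _ "\<lambda>t. - t * ?r t ^ 3"] DERIV_inverse_sqrt) auto
qed

lemma Ck_on_squash: "Ck_on UNIV {} k squash"
  unfolding squash_def[abs_def] by (intro Ck_on_mult Ck_on_id Ck_on_inverse_sqrt)

lemma squash_minus [simp]: "squash (- t) = - squash t"
  by (simp add: squash_def)

lemma squash_less: "squash t < 1"
proof -
  have "t < sqrt (1 + t\<^sup>2)" by (rule real_less_rsqrt) simp
  then show ?thesis using sqrt_1_plus_square_pos[of t] by (simp add: squash_def field_simps)
qed

lemma squash_pos: "0 < t \<Longrightarrow> 0 < squash t"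
  using sqrt_1_plus_square_pos[of t] by (simp add: squash_def)

lemma squash_le: "0 < t \<Longrightarrow> squash t \<le> t"
proof -
  have "1 \<le> sqrt (1 + t\<^sup>2)" by simp
  then show "0 < t \<Longrightarrow> squash t \<le> t"
    using sqrt_1_plus_square_pos[of t] by (simp add: squash_def field_simps)
qed

lemma squash_strict_mono:
  assumes "x < y"
  shows "squash x < squash y"
proof (rule DERIV_pos_imp_increasing[of x y squash, OF assms])
  fix t :: real
  let ?r = "inverse (sqrt (1 + t\<^sup>2))"
  have r: "?r\<^sup>2 * (1 + t\<^sup>2) = 1"
    using sqrt_1_plus_square_pos[of t] by (simp add: power_inverse add_nonneg_eq_0_iff add_pos_nonneg less_imp_neq[symmetric])
  have "(squash has_real_derivative 1 * ?r + t * (- t * ?r ^ 3)) (at t)"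
    unfolding squash_def[abs_def]
    by (rule derivative_eq_intros DERIV_inverse_sqrt refl)+ simp
  \<comment> \<open>The first term is expanded by the identity \<open>r\<close>; the terms with
    \<open>t\<^sup>2\<close> then cancel.\<close>
  also have "1 * ?r + t * (- t * ?r ^ 3) = ?r * (?r\<^sup>2 * (1 + t\<^sup>2)) - t\<^sup>2 * ?r ^ 3"
    unfolding r by (simp add: power2_eq_square)
  also have "\<dots> = ?r ^ 3" by (simp add: algebra_simps power2_eq_square power3_eq_cube)
  finally show "\<exists>D. (squash has_real_derivative D) (at t) \<and> 0 < D"
    using sqrt_1_plus_square_pos[of t] by (intro exI[of _ "?r ^ 3"]) simp
qed

section \<open>Construction of the comparison function\<close>

context o_minimal_structure
begin

lemma defm_squash: "defm squash"
  unfolding squash_def[abs_def]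
  by (intro def_intros defm_inverse defm_sqrt sqrt_1_plus_square_pos) simp

lemma exists_Phi_le:
  fixes g :: "real \<Rightarrow> real"
  assumes g: "defm g" and mono: "mono_on {0<..} g"
    and g_pos: "\<And>t. 0 < t \<Longrightarrow> 0 < g t" and g_le: "\<And>t. 0 < t \<Longrightarrow> g t \<le> 1"
  shows "\<exists>\<phi>\<in>Phi p. defm \<phi> \<and> (\<forall>t. 0 < t \<and> t \<le> T \<longrightarrow> \<phi> t \<le> g t)"
proof -
  obtain \<epsilon> where \<epsilon>: "0 < \<epsilon>" "continuous_on {0<..<\<epsilon>} g"
    using eventually_continuous_if_mono[OF g mono] by blast
  let ?u = "\<lambda>t. t * g t"
  \<comment> \<open>The extra factor \<open>t\<close> forces the limit \<open>0\<close>, whatever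
    the right limit of the bounded function \<open>g\<close> may be.\<close>
  have "(?u \<longlongrightarrow> 0) (at_right 0)"
  proof (rule tendsto_sandwich[of "\<lambda>_. 0" _ _ "\<lambda>t. t"])
    show "\<forall>\<^sub>F t in at_right 0. 0 \<le> ?u t" "\<forall>\<^sub>F t in at_right 0. ?u t \<le> t"
      using eventually_at_right_less[of "0::real"]
      by (auto elim!: eventually_mono intro!: mult_left_le g_le less_imp_le[OF g_pos] mult_nonneg_nonneg)
  qed (auto intro: tendsto_ident_at)
  moreover have "continuous_on {0<..<\<epsilon>} ?u" by (intro continuous_intros \<epsilon>(2))
  ultimately obtain \<delta>' where \<delta>': "0 < \<delta>'" "Ck_on {-\<delta>'<..<\<delta>'} {0} p (reflect (- 1) (\<lambda>t. t ^ p * ?u t))"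
    using flat_reflect_power_mult[of ?u \<epsilon> p] \<epsilon>(1) defm_mult[OF defm_id g] by blast
  define \<delta> where "\<delta> = min \<delta>' 1"
  have \<delta>: "0 < \<delta>" "\<delta> \<le> 1" "\<delta> \<le> \<delta>'" using \<delta>'(1) by (auto simp: \<delta>_def)
  define \<psi> where "\<psi> = reflect (- 1) (\<lambda>t. t ^ p * ?u t)"
  \<comment> \<open>Chosen so that the factor \<open>c * (1 + t * t)\<close> is at most
    \<open>1\<close> for \<open>0 < t \<le> T\<close>.\<close>
  define c where "c = inverse (1 + T\<^sup>2)"
  have c: "0 < c" by (simp add: c_def add_pos_nonneg)
  \<comment> \<open>Since \<open>squash\<close> takes values in \<open>(-1, 1)\<close>, the argument
    of \<open>\<psi>\<close> stays where \<open>\<psi>\<close> is of class \<open>Ck_on\<close>. The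
    unbounded factor \<open>1 + t * t\<close> makes up for the bounded argument and gives
    surjectivity.\<close>
  define \<phi> where "\<phi> t = \<psi> (\<delta> * squash t) * (c * (1 + t * t))" for t
  have "Ck_on UNIV {0} p (\<lambda>t. \<psi> (\<delta> * squash t))"
  proof (rule Ck_on_compose[of "{-\<delta>'<..<\<delta>'}" "{0}" p \<psi> _ "\<lambda>t. \<delta> * squash t"])
    show "Ck_on {-\<delta>'<..<\<delta>'} {0} p \<psi>" unfolding \<psi>_def by (rule \<delta>')
    show "Ck_on UNIV {} p (\<lambda>t. \<delta> * squash t)" by (intro Ck_on_mult Ck_on_const Ck_on_squash)
    have "\<delta> * squash t < \<delta>'" "- \<delta>' < \<delta> * squash t" for t
    proof -
      have *: "\<delta> * squash t < \<delta> * 1" for t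
        using \<delta>(1) squash_less by (intro mult_strict_left_mono) auto
      from *[of t] *[of "-t"] \<delta>(3) show "\<delta> * squash t < \<delta>'" "- \<delta>' < \<delta> * squash t" by auto
    qed
    then show "range (\<lambda>t. \<delta> * squash t) \<subseteq> {-\<delta>'<..<\<delta>'}" by auto
  qed (simp add: squash_def)
  then have Ck: "Ck_on UNIV {0} p \<phi>"
    unfolding \<phi>_def[abs_def] by (intro Ck_on_mult Ck_on_add Ck_on_const Ck_on_id)
  have \<psi>_pos: "\<psi> (\<delta> * squash t) = (\<delta> * squash t) ^ Suc p * g (\<delta> * squash t)" "0 < \<delta> * squash t"
    if "0 < t" for t
    using squash_pos[OF that] \<delta>(1) by (auto simp: \<psi>_def reflect_def)
  have \<psi>_gt_0: "0 < \<psi> (\<delta> * squash t)" if "0 < t" for t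
    using \<psi>_pos[OF that] g_pos by simp
  \<comment> \<open>Weak monotonicity is enough for this factor; strictness of \<open>\<phi>\<close>
    comes from \<open>1 + t * t\<close>.\<close>
  have \<psi>_mono: "\<psi> (\<delta> * squash x) \<le> \<psi> (\<delta> * squash y)" if "0 < x" "x \<le> y" for x y
  proof -
    have "squash x \<le> squash y" using squash_strict_mono[of x y] that by (cases "x = y") auto
    then have *: "\<delta> * squash x \<le> \<delta> * squash y" using \<delta>(1) by simp
    then have "g (\<delta> * squash x) \<le> g (\<delta> * squash y)"
      using \<psi>_pos[of x] \<psi>_pos[of y] that by (intro mono_onD[OF mono]) auto
    with * show ?thesis
      unfolding \<psi>_pos(1)[OF that(1)] \<psi>_pos(1)[OF less_le_trans[OF that]]
      using \<psi>_pos(2)[of x] \<psi>_pos(2)[of y] that g_pos[of "\<delta> * squash x"]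
      by (intro mult_mono[OF power_mono]) (auto intro: zero_le_power simp del: power_Suc)
  qed
  have odd: "\<phi> (- t) = - \<phi> t" for t
    by (auto simp: \<phi>_def \<psi>_def reflect_def)
  then have \<phi>0: "\<phi> 0 = 0" using Ck_on_zero[OF Ck] by simp
  have \<phi>_pos: "0 < \<phi> t" if "0 < t" for t
    using \<psi>_gt_0[OF that] c by (auto simp: \<phi>_def intro!: mult_pos_pos add_pos_nonneg)
  have \<phi>_less: "\<phi> x < \<phi> y" if "0 < x" "x < y" for x y
  proof -
    have "x * x < y * y" using that by (intro mult_strict_mono) auto
    then have "c * (1 + x * x) < c * (1 + y * y)" using c by simp
    then show ?thesis
      unfolding \<phi>_def using \<psi>_mono[of x y] \<psi>_gt_0[of x] \<psi>_gt_0[of y] that c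
      by (intro mult_le_less_imp_less) (auto intro!: mult_nonneg_nonneg)
  qed
  have \<phi>_mono: "strict_mono \<phi>"
  proof (rule strict_monoI)
    fix x y :: real assume "x < y"
    consider "0 < x" | "x = 0" | "x < 0" "0 \<le> y" | "y < 0" using \<open>x < y\<close> by linarith
    then show "\<phi> x < \<phi> y"
    proof cases
      case 1
      with \<open>x < y\<close> show ?thesis by (intro \<phi>_less)
    next
      case 2
      with \<open>x < y\<close> show ?thesis using \<phi>_pos \<phi>0 by simp
    next
      case 3
      then have "\<phi> x < 0" using \<phi>_pos[of "- x"] odd[of x] by simp
      moreover have "0 \<le> \<phi> y" using \<phi>_pos[of y] \<phi>0 3 by (cases "y = 0") auto
      ultimately show ?thesis by simp
    next
      case 4
      then show ?thesis using \<phi>_less[of "- y" "- x"] odd \<open>x < y\<close> by simp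
    qed
  qed
  have cont: "continuous_on UNIV \<phi>"
  proof -
    have "Ck_on UNIV {0} 0 \<phi>" using Ck by (induction p) (auto dest: Ck_on_SucD simp del: Ck_on.simps)
    then show ?thesis by simp
  qed
  have surj_pos: "\<exists>t. \<phi> t = y" if "0 \<le> y" for y
  proof -
    define m where "m = \<psi> (\<delta> * squash 1)"
    have m: "0 < m" unfolding m_def by (rule \<psi>_gt_0) simp
    \<comment> \<open>\<open>1 \<le> t\<close> keeps the \<open>\<psi>\<close> factor at least
      \<open>m\<close> and gives \<open>t \<le> t * t\<close>; \<open>y / (m * c) \<le> t\<close>
      then makes the product reach \<open>y\<close>.\<close>
    define t where "t = max 1 (y / (m * c))"
    have t: "1 \<le> t" "y / (m * c) \<le> t" by (auto simp: t_def)
    have "y \<le> m * (c * t)" using t(2) m c by (simp add: field_simps)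
    also have "\<dots> \<le> m * (c * (1 + t * t))"
    proof -
      have "t * 1 \<le> t * t" using t(1) by (intro mult_left_mono) auto
      then show ?thesis using m c by simp
    qed
    also have "\<dots> \<le> \<phi> t"
      unfolding \<phi>_def m_def using \<psi>_mono[of 1 t] t(1) c
      by (intro mult_right_mono) (auto intro!: mult_nonneg_nonneg)
    finally have "y \<le> \<phi> t" .
    then have "\<exists>x\<ge>0. x \<le> t \<and> \<phi> x = y"
      using that t(1) \<phi>0 by (intro IVT') (auto intro: continuous_on_subset[OF cont])
    then show ?thesis by blast
  qed
  have "surj \<phi>"
  proof -
    have "\<exists>t. \<phi> t = y" for y
    proof (cases "0 \<le> y")
      case False
      then obtain t where "\<phi> t = - y" using surj_pos[of "- y"] by auto
      then have "\<phi> (- t) = y" using odd by simp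
      then show ?thesis by blast
    qed (rule surj_pos)
    then show ?thesis by (metis surjI)
  qed
  then have "bij \<phi>" using strict_mono_imp_inj_on[OF \<phi>_mono] by (simp add: bij_def)
  with odd \<phi>_mono C_k_real_if_Ck_on[OF Ck] have "\<phi> \<in> Phi p" by (simp add: Phi_def)
  moreover have "defm \<phi>"
    unfolding \<phi>_def[abs_def] \<psi>_def reflect_def
    by (intro defm_if def_intros defm_comp[OF g] defm_comp[OF defm_squash])
  moreover have "\<phi> t \<le> g t" if t: "0 < t" "t \<le> T" for t
  proof -
    \<comment> \<open>The point \<open>?s\<close> lies in \<open>(0, 1]\<close> and below
      \<open>t\<close>: the power of \<open>?s\<close> is at most \<open>1\<close>, and monotonicity
      passes from \<open>g ?s\<close> to \<open>g t\<close>.\<close>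
    let ?s = "\<delta> * squash t"
    have "?s \<le> 1 * squash t" using \<delta>(2) squash_pos[OF t(1)] by (intro mult_right_mono) auto
    then have s: "0 < ?s" "?s \<le> t" "?s \<le> 1"
      using squash_le[OF t(1)] squash_less[of t] \<psi>_pos(2)[OF t(1)] by auto
    have "t * t \<le> T\<^sup>2" using t by (simp add: power2_eq_square mult_mono)
    then have "c * (1 + t * t) \<le> 1"
      unfolding c_def by (simp add: field_simps add_pos_nonneg)
    moreover have "\<psi> ?s \<le> g ?s"
    proof -
      have "?s ^ Suc p \<le> 1" using s by (intro power_le_one) auto
      then have "?s ^ Suc p * g ?s \<le> 1 * g ?s" using g_pos[OF s(1)] by (intro mult_right_mono) auto
      then show ?thesis using \<psi>_pos(1)[OF t(1)] by simp
    qed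
    ultimately have "\<phi> t \<le> g ?s * 1"
      unfolding \<phi>_def using g_pos[OF s(1)] c by (intro mult_mono) auto
    also have "\<dots> \<le> g t" using s t by (auto intro!: mono_onD[OF mono])
    finally show ?thesis .
  qed
  ultimately show ?thesis by blast
qed

end

section \<open>Hausdorff distance and continuous multifunctions\<close>

lemma hausdorff_dist_nonneg:
  assumes "A \<noteq> {}" "bdd_above ((\<lambda>x. infdist x B) ` A)"
  shows "0 \<le> hausdorff_dist A B"
proof -
  obtain x where "x \<in> A" using assms(1) by blast
  then have "0 \<le> (SUP x\<in>A. infdist x B)"
    using order_trans[OF infdist_nonneg cSUP_upper[OF _ assms(2)]] by blast
  then show ?thesis by (simp add: hausdorff_dist_def)
qed

lemma bdd_above_infdist_compact: "compact A \<Longrightarrow> bdd_above ((\<lambda>x. infdist x B) ` A)"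
  by (intro bounded_imp_bdd_above compact_imp_bounded compact_continuous_image continuous_intros)

text \<open>For nonempty compact sets this is equivalent to Hausdorff distance at least
  \<open>r\<close>, but it is a first-order condition on points, without infima or suprema.\<close>

definition far_apart :: "real \<Rightarrow> 'a::metric_space set \<Rightarrow> 'a set \<Rightarrow> bool"
  where "far_apart r A B \<longleftrightarrow> (\<exists>u\<in>A. \<forall>v\<in>B. r \<le> dist u v) \<or> (\<exists>v\<in>B. \<forall>u\<in>A. r \<le> dist u v)"

lemma hausdorff_dist_ge:
  assumes "compact A" "compact B" "A \<noteq> {}" "B \<noteq> {}" "far_apart r A B"
  shows "r \<le> hausdorff_dist A B"
  using assms(5) unfolding far_apart_def
proof
  assume "\<exists>u\<in>A. \<forall>v\<in>B. r \<le> dist u v"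
  then obtain u where u: "u \<in> A" "\<forall>v\<in>B. r \<le> dist u v" by blast
  have "r \<le> infdist u B"
    using u(2) assms(4) by (auto simp: infdist_notempty intro: cINF_greatest)
  also have "\<dots> \<le> (SUP x\<in>A. infdist x B)"
    using u(1) assms(1) by (intro cSUP_upper bdd_above_infdist_compact)
  finally show ?thesis by (simp add: hausdorff_dist_def)
next
  assume "\<exists>v\<in>B. \<forall>u\<in>A. r \<le> dist u v"
  then obtain v where v: "v \<in> B" "\<forall>u\<in>A. r \<le> dist u v" by blast
  have "r \<le> infdist v A"
    using v(2) assms(3) by (auto simp: infdist_notempty dist_commute intro: cINF_greatest)
  also have "\<dots> \<le> (SUP x\<in>B. infdist x A)"
    using v(1) assms(2) by (intro cSUP_upper bdd_above_infdist_compact)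
  finally show ?thesis by (simp add: hausdorff_dist_def)
qed

text \<open>The values \<open>F (xs k)\<close> approach \<open>B\<close> in Hausdorff distance,
  while continuity makes them approach \<open>F x\<close>. The limits in
  \<open>mf_continuous_at\<close> are punctured, so a sequence that returns to \<open>x\<close>
  infinitely often is treated separately.\<close>

lemma limit_value_eq:
  fixes F :: "'a::metric_space \<Rightarrow> 'b::metric_space set"
  assumes cont: "mf_continuous_at F x" and B: "closed B"
    and xs: "\<And>k. xs k \<in> mf_dom F" "xs \<longlonglongrightarrow> x"
    and r: "r \<longlonglongrightarrow> 0" and near: "\<And>k. \<not> far_apart (r k) (F (xs k)) B"
    and closed_x: "closed (F x)"
  shows "F x = B"
proof -
  have near1: "\<exists>v\<in>B. dist u v < r k" if "u \<in> F (xs k)" for u k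
    using near[of k] that unfolding far_apart_def by (auto simp: not_le)
  have near2: "\<exists>u\<in>F (xs k). dist u v < r k" if "v \<in> B" for v k
    using near[of k] that unfolding far_apart_def by (auto simp: not_le)
  show ?thesis
  proof (cases "\<exists>\<^sub>F k in sequentially. xs k = x")
    case True
    then obtain \<sigma> :: "nat \<Rightarrow> nat" where \<sigma>: "strict_mono \<sigma>" "\<And>k. xs (\<sigma> k) = x"
      unfolding frequently_sequentially
      using infinite_enumerate[of "{k. xs k = x}"]
      by (metis (mono_tags, lifting) infinite_nat_iff_unbounded_le mem_Collect_eq)
    \<comment> \<open>Along this subsequence the value is constantly \<open>F x\<close>, so
      \<open>F x\<close> and \<open>B\<close> are arbitrarily close to each other and, being closed,
      equal.\<close>
    have r\<sigma>: "(\<lambda>k. r (\<sigma> k)) \<longlonglongrightarrow> 0"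
      using LIMSEQ_subseq_LIMSEQ[OF r \<sigma>(1)] by (simp add: o_def)
    have small: "\<exists>k. r (\<sigma> k) < e" if "0 < e" for e
      using order_tendstoD(2)[OF r\<sigma> that] by (auto simp: eventually_sequentially)
    show ?thesis
    proof (intro equalityI subsetI)
      fix u assume u: "u \<in> F x"
      have "\<exists>v\<in>B. dist v u < e" if "0 < e" for e
        using small[OF that] near1[of u "\<sigma> _"] u \<sigma>(2) by (metis dist_commute less_trans)
      then show "u \<in> B" using B by (metis closed_approachable)
    next
      fix v assume v: "v \<in> B"
      have "\<exists>u\<in>F x. dist u v < e" if "0 < e" for e
        using small[OF that] near2[OF v, of "\<sigma> _"] \<sigma>(2) by (metis less_trans)
      then show "v \<in> F x" using closed_x by (metis closed_approachable)
    qed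
  next
    case False
    then obtain N where N: "\<And>k. N \<le> k \<Longrightarrow> xs k \<noteq> x"
      by (auto simp: frequently_def eventually_sequentially)
    define ys where "ys k = xs (k + N)" for k
    have ys: "\<And>k. ys k \<in> mf_dom F - {x}" "ys \<longlonglongrightarrow> x"
      using xs N LIMSEQ_ignore_initial_segment[OF xs(2), of N] by (auto simp: ys_def[abs_def])
    have rN: "(\<lambda>k. r (k + N)) \<longlonglongrightarrow> 0" by (rule LIMSEQ_ignore_initial_segment[OF r])
    have "x \<in> closure (mf_dom F - {x})"
      using ys unfolding closure_sequential by blast
    with cont have F: "mf_liminf F x = F x" "mf_limsup F x = F x"
      by (auto simp: mf_continuous_at_def)
    show ?thesis
    proof (intro equalityI subsetI)
      fix u assume "u \<in> F x"
      then have "u \<in> mf_liminf F x" using F by simp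
      then obtain us where us: "\<And>k. us k \<in> F (ys k)" "us \<longlonglongrightarrow> u"
        using ys unfolding mf_liminf_def by blast
      \<comment> \<open>The points \<open>us k\<close>, supplied by the lower limit, are replaced by
        points of \<open>B\<close> at vanishing distance; these also converge to \<open>u\<close>,
        and \<open>B\<close> is closed.\<close>
      have "\<forall>k. \<exists>v. v \<in> B \<and> dist (us k) v < r (k + N)"
        using near1 us(1) unfolding ys_def by blast
      then obtain vs where vs: "\<And>k. vs k \<in> B" "\<And>k. dist (us k) (vs k) < r (k + N)" by metis
      have "(\<lambda>k. dist (us k) (vs k)) \<longlonglongrightarrow> 0"
        by (rule tendsto_sandwich[OF _ _ tendsto_const rN]) (auto intro!: always_eventually less_imp_le vs)
      from tendsto_add[OF this us(2)[THEN tendsto_dist_iff[THEN iffD1]]]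
      have "(\<lambda>k. dist (us k) (vs k) + dist (us k) u) \<longlonglongrightarrow> 0" by simp
      then have "(\<lambda>k. dist (vs k) u) \<longlonglongrightarrow> 0"
        by (rule tendsto_sandwich[OF always_eventually always_eventually tendsto_const, rotated 2])
           (simp_all add: dist_triangle3)
      then have "vs \<longlonglongrightarrow> u" by (rule tendsto_dist_iff[THEN iffD2])
      with B vs(1) show "u \<in> B" by (metis closed_sequentially)
    next
      fix v assume v: "v \<in> B"
      \<comment> \<open>Conversely, \<open>v\<close> is a limit of points of \<open>F (ys k)\<close>
        and thus belongs to the upper limit.\<close>
      have "\<forall>k. \<exists>u. u \<in> F (ys k) \<and> dist u v < r (k + N)"
        using near2[OF v] unfolding ys_def by blast
      then obtain us where us: "\<And>k. us k \<in> F (ys k)" "\<And>k. dist (us k) v < r (k + N)" by metis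
      have "(\<lambda>k. dist (us k) v) \<longlonglongrightarrow> 0"
        by (rule tendsto_sandwich[OF _ _ tendsto_const rN]) (auto intro!: always_eventually less_imp_le us)
      then have "us \<longlonglongrightarrow> v" by (rule tendsto_dist_iff[THEN iffD2])
      then have "v \<in> mf_limsup F x" using ys us(1) unfolding mf_limsup_def by blast
      then show "v \<in> F x" using F by simp
    qed
  qed
qed

text \<open>Otherwise points of \<open>K\<close> at distance at least \<open>t\<close> from the
  strong preimage violate the bound for radii tending to \<open>0\<close>. A limit point
  \<open>x\<close> in \<open>K\<close> has \<open>F x = F a\<close>, hence distance
  \<open>0\<close>, while continuity of the distance keeps it at least \<open>t\<close>.\<close>

lemma uniformly_far_apart:
  fixes F :: "'a::metric_space \<Rightarrow> 'b::metric_space set"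
  assumes cont: "mf_continuous F" and vals: "\<And>x. closed (F x)"
    and K: "compact K" "K \<subseteq> mf_dom F" and B: "B \<noteq> {}" and t: "0 < t"
  obtains r where "0 < r" "r \<le> 1"
    "\<forall>x\<in>K. t \<le> infdist x (strong_preimage F (F a)) \<longrightarrow> far_apart r (F x) (F a)"
proof (rule ccontr)
  let ?P = "strong_preimage F (F a)"
  assume "\<not> thesis"
  with that have "\<exists>x\<in>K. t \<le> infdist x ?P \<and> \<not> far_apart r (F x) (F a)" if "0 < r" "r \<le> 1" for r
    using that by blast
  then have "\<forall>k. \<exists>x. x \<in> K \<and> t \<le> infdist x ?P \<and> \<not> far_apart (inverse (real (Suc k))) (F x) (F a)"
    by (auto simp: inverse_le_1_iff Bex_def)
  then obtain xs where xs: "\<And>k. xs k \<in> K" "\<And>k. t \<le> infdist (xs k) ?P"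
    "\<And>k. \<not> far_apart (inverse (real (Suc k))) (F (xs k)) (F a)" by metis
  obtain x \<sigma> where \<sigma>: "x \<in> K" "strict_mono \<sigma>" "(xs \<circ> \<sigma>) \<longlonglongrightarrow> x"
    using K(1) xs(1) unfolding compact_def by metis
  have "F x = F a"
  proof (rule limit_value_eq)
    show "mf_continuous_at F x" using cont K(2) \<sigma>(1) by (auto simp: mf_continuous_def)
    show "(\<lambda>k. inverse (real (Suc (\<sigma> k)))) \<longlonglongrightarrow> 0"
      using LIMSEQ_subseq_LIMSEQ[OF LIMSEQ_inverse_real_of_nat \<sigma>(2)] by (simp add: o_def)
  qed (use xs K(2) \<sigma>(3) vals in auto)
  then have "infdist x ?P = 0" by (intro infdist_zero) (simp add: strong_preimage_def)
  moreover have "(\<lambda>k. infdist ((xs \<circ> \<sigma>) k) ?P) \<longlonglongrightarrow> infdist x ?P"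
    by (rule tendsto_infdist[OF \<sigma>(3)])
  then have "t \<le> infdist x ?P"
    by (rule LIMSEQ_le_const) (use xs(2) in auto)
  ultimately show False using t by simp
qed

lemma le_infdist_iff:
  "A \<noteq> {} \<Longrightarrow> t \<le> infdist x A \<longleftrightarrow> (\<forall>z\<in>A. t \<le> dist x z)"
  by (auto simp: infdist_notempty intro: cINF_greatest dest: order_trans[OF _ cINF_lower[OF bdd_below_image_dist]])

section \<open>Definability of sets, multifunctions and suprema\<close>

context o_minimal_structure
begin

lemma defp_of_definable_set: "definable_set S A \<Longrightarrow> defp (\<lambda>x :: real ^ 'n. x \<in> A)"
  by (simp add: definable_set_def defp_def crd_eq_coords cdim_real_vec image_def)

lemma defp_of_definable_mf:
  fixes F :: "real ^ 'm \<Rightarrow> (real ^ 'n) set"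
  assumes "definable_mf S F"
  shows "defp (\<lambda>z. snd z \<in> F (fst z))"
proof -
  have "crd ` {z. snd z \<in> F (fst z)} = {coords x @ coords y | x y. y \<in> F x}"
    by (auto simp: crd_prod_def crd_eq_coords image_def)
  with assms show ?thesis
    by (simp add: definable_mf_def defp_def cdim_prod_def cdim_real_vec)
qed

lemma definable_fun_if_defm:
  assumes "defm f"
  shows "definable_fun S f"
proof -
  have "crd ` {z :: real \<times> real. snd z = f (fst z)} = {[t, f t] | t. True}"
    by (auto simp: crd_prod_def crd_real_def image_iff)
  with assms show ?thesis
    by (simp add: definable_fun_def defm_def defp_def cdim_prod_def cdim_real_def numeral_2_eq_2)
qed

text \<open>For nonempty bounded sets the supremum is characterised by the first-order least upper
  bound property.\<close>

lemma defm_Sup: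
  fixes P :: "'a::coord \<Rightarrow> real \<Rightarrow> bool"
  assumes P: "defp (\<lambda>z. P (fst z) (snd z))"
    and ex: "\<And>x. \<exists>y. P x y" and bdd: "\<And>x. bdd_above {y. P x y}"
  shows "defm (\<lambda>x. Sup {y. P x y})"
proof -
  have "snd z = Sup {y. P (fst z) y} \<longleftrightarrow>
      (\<forall>y. P (fst z) y \<longrightarrow> y \<le> snd z) \<and> (\<forall>b. (\<forall>y. P (fst z) y \<longrightarrow> y \<le> b) \<longrightarrow> snd z \<le> b)" for z
  proof
    assume "snd z = Sup {y. P (fst z) y}"
    with ex[of "fst z"] bdd[of "fst z"] show "(\<forall>y. P (fst z) y \<longrightarrow> y \<le> snd z) \<and> (\<forall>b. (\<forall>y. P (fst z) y \<longrightarrow> y \<le> b) \<longrightarrow> snd z \<le> b)"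
      by (auto intro: cSup_upper cSup_least)
  next
    assume "(\<forall>y. P (fst z) y \<longrightarrow> y \<le> snd z) \<and> (\<forall>b. (\<forall>y. P (fst z) y \<longrightarrow> y \<le> b) \<longrightarrow> snd z \<le> b)"
    with ex[of "fst z"] show "snd z = Sup {y. P (fst z) y}"
      by (intro cSup_eq_non_empty[symmetric]) auto
  qed
  then show ?thesis
    unfolding defm_def by (simp only:) (intro def_intros defp_subst2[OF P])
qed

end

theorem theorem5p17:
  fixes S :: "nat \<Rightarrow> real list set set"
    and F :: "real ^ 'm \<Rightarrow> (real ^ 'n) set"
    and a :: "real ^ 'm" and K :: "(real ^ 'm) set" and p :: nat
  assumes "o_minimal_structure S" and "p \<ge> 1"
    and "definable_mf S F" and "mf_continuous F" and "\<And>x. compact (F x)"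
    and "a \<in> mf_dom F"
    and "compact K" and "definable_set S K" and "a \<in> interior K" and "K \<subseteq> mf_dom F"
  shows "\<exists>\<phi>\<in>Phi p. definable_fun S \<phi> \<and>
    (\<forall>x\<in>K. hausdorff_dist (F x) (F a) \<ge> \<phi> (infdist x (strong_preimage F (F a))))"
proof -
  interpret o_minimal_structure S by fact
  let ?P = "strong_preimage F (F a)"
  have aP: "a \<in> ?P" by (simp add: strong_preimage_def)
  have Fa: "F a \<noteq> {}" using assms(6) by (simp add: mf_dom_def)
  \<comment> \<open>The bound \<open>r \<le> 1\<close> keeps the admissible radii bounded, and the
    guard \<open>0 < t\<close> makes \<open>r = 1\<close> admissible for the remaining
    \<open>t\<close>; so the supremum exists for every real \<open>t\<close>, as
    \<open>defm_Sup\<close> requires.\<close>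
  define Q where "Q t r \<longleftrightarrow> 0 < r \<and> r \<le> 1 \<and> (0 < t \<longrightarrow>
    (\<forall>x\<in>K. t \<le> infdist x ?P \<longrightarrow> far_apart r (F x) (F a)))" for t r
  define g where "g t = Sup {r. Q t r}" for t
  have F_def: "defp (\<lambda>z. h z \<in> F (f z))" if "defm f" "defm h"
    for f :: "'a::coord \<Rightarrow> real ^ 'm" and h :: "'a \<Rightarrow> real ^ 'n"
    by (rule defp_subst2[OF defp_of_definable_mf[OF assms(3)] that])
  have K_def: "defp (\<lambda>z. f z \<in> K)" if "defm f" for f :: "'a::coord \<Rightarrow> real ^ 'm"
    by (rule defp_subst[OF defp_of_definable_set[OF assms(8)] that])
  \<comment> \<open>The distance to the strong preimage, equality of values and bounded quantifiers
    are expanded until only definable atoms remain.\<close>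
  have Q_unfold: "Q t r \<longleftrightarrow> 0 < r \<and> r \<le> 1 \<and> (0 < t \<longrightarrow>
    (\<forall>x. x \<in> K \<longrightarrow> (\<forall>z. (\<forall>y. (y \<in> F z \<longrightarrow> y \<in> F a) \<and> (y \<in> F a \<longrightarrow> y \<in> F z)) \<longrightarrow> t \<le> dist x z) \<longrightarrow>
      (\<exists>u. u \<in> F x \<and> (\<forall>v. v \<in> F a \<longrightarrow> r \<le> dist u v)) \<or>
      (\<exists>v. v \<in> F a \<and> (\<forall>u. u \<in> F x \<longrightarrow> r \<le> dist u v))))" for t r
  proof -
    have "t \<le> infdist x ?P \<longleftrightarrow>
      (\<forall>z. (\<forall>y. (y \<in> F z \<longrightarrow> y \<in> F a) \<and> (y \<in> F a \<longrightarrow> y \<in> F z)) \<longrightarrow> t \<le> dist x z)" for x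
    proof -
      have "?P \<noteq> {}" using aP by blast
      then show ?thesis
        unfolding le_infdist_iff[OF \<open>?P \<noteq> {}\<close>] by (auto simp: strong_preimage_def set_eq_iff)
    qed
    then show ?thesis by (simp only: Q_def far_apart_def Ball_def Bex_def)
  qed
  have Q_def': "defp (\<lambda>z. Q (fst z) (snd z))"
    unfolding Q_unfold by (intro def_intros F_def K_def defm_dist)
  have Q_ex: "\<exists>r. Q t r" for t
  proof (cases "0 < t")
    case True
    obtain r where "0 < r" "r \<le> 1" "\<forall>x\<in>K. t \<le> infdist x ?P \<longrightarrow> far_apart r (F x) (F a)"
      by (rule uniformly_far_apart[OF assms(4) _ assms(7,10) Fa True])
         (use assms(5) compact_imp_closed in auto)
    then show ?thesis by (auto simp: Q_def)
  qed (auto simp: Q_def intro!: exI[of _ 1])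
  have Q_bdd: "bdd_above {r. Q t r}" for t
    by (rule bdd_aboveI[of _ 1]) (simp add: Q_def)
  have g_upper: "r \<le> g t" if "Q t r" for t r
    unfolding g_def using that Q_bdd by (intro cSup_upper) auto
  have g_least: "g t \<le> b" if "\<And>r. Q t r \<Longrightarrow> r \<le> b" for t b
    unfolding g_def using that Q_ex by (intro cSup_least) auto
  have "defm g"
    unfolding g_def[abs_def] by (rule defm_Sup[OF Q_def' Q_ex Q_bdd])
  moreover have "mono_on {0<..} g"
  proof (rule mono_onI)
    fix s t :: real assume st: "s \<in> {0<..}" "s \<le> t"
    show "g s \<le> g t"
    proof (rule g_least)
      \<comment> \<open>A larger threshold constrains fewer points of \<open>K\<close>, so radii
        admissible for \<open>s\<close> remain admissible for \<open>t\<close>.\<close>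
      fix r assume "Q s r"
      then have "Q t r" using st unfolding Q_def by auto
      then show "r \<le> g t" by (rule g_upper)
    qed
  qed
  moreover have "0 < g t" for t
    using Q_ex[of t] g_upper[of t] by (auto simp: Q_def intro: less_le_trans)
  moreover have "g t \<le> 1" for t
    by (rule g_least) (simp add: Q_def)
  \<comment> \<open>By compactness the distances occurring on \<open>K\<close> are bounded, so a
    comparison on \<open>(0, T]\<close> suffices.\<close>
  moreover obtain T where T: "\<And>x. x \<in> K \<Longrightarrow> infdist x ?P \<le> T"
  proof -
    have "bdd_above ((\<lambda>x. infdist x ?P) ` K)" by (rule bdd_above_infdist_compact[OF assms(7)])
    then show thesis using that by (auto simp: bdd_above_def)
  qed
  ultimately obtain \<phi> where \<phi>: "\<phi> \<in> Phi p" "defm \<phi>" "\<And>t. 0 < t \<Longrightarrow> t \<le> T \<Longrightarrow> \<phi> t \<le> g t"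
    using exists_Phi_le[of g p T] by blast
  have "\<phi> (infdist x ?P) \<le> hausdorff_dist (F x) (F a)" if x: "x \<in> K" for x
  proof (cases "infdist x ?P = 0")
    case True
    have "\<phi> (- 0) = - \<phi> 0" using \<phi>(1) unfolding Phi_def by blast
    then have "\<phi> 0 = 0" by simp
    moreover have "0 \<le> hausdorff_dist (F x) (F a)"
      using x assms(5,10) by (intro hausdorff_dist_nonneg bdd_above_infdist_compact) (auto simp: mf_dom_def)
    ultimately show ?thesis using True by simp
  next
    case False
    then have pos: "0 < infdist x ?P" using infdist_nonneg[of x ?P] by simp
    have "\<phi> (infdist x ?P) \<le> g (infdist x ?P)" using \<phi>(3)[OF pos T[OF x]] .
    also have "\<dots> \<le> hausdorff_dist (F x) (F a)"
    proof (rule g_least)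
      \<comment> \<open>Every admissible radius is a lower bound for the Hausdorff distance at
        \<open>x\<close>, hence so is their supremum, attained or not.\<close>
      fix r assume "Q (infdist x ?P) r"
      then have "far_apart r (F x) (F a)" using x pos by (simp add: Q_def)
      then show "r \<le> hausdorff_dist (F x) (F a)"
        using x Fa assms(5,10) by (intro hausdorff_dist_ge) (auto simp: mf_dom_def)
    qed
    finally show ?thesis .
  qed
  with \<phi>(1) definable_fun_if_defm[OF \<phi>(2)] show ?thesis by blast
qed

end
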